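(* Let $T$ be a partially bounded rank-one transformation of $(X,\mu)$. Then every transformation $S'\in C(T)$ is a power of $T$; that is, if $S'$ is an invertible measure-preserving transformation of $X$ with $S'\circ T=T\circ S'$ a.e., then there is $\rho\in\mathbb{Z}$ such that $S'=T^{\rho}$ a.e.
   Context: All equalities of sets/maps, invertibility, etc. are understood up to null sets (a.e.). Rank-one transformations (cutting and stacking). Let $(r_n)_{n\ge 0}$ be integers $r_n\ge 2$ (cutting parameters) and, for each $n$, let $s_n=(s_n(0),\dots,s_n(r_n-1))$ be an $r_n$-tuple of non-negative integers (spacer parameters). A column of height $h$ is a finite ordered sequence of $h$ disjoint left-closed right-open intervals (levels) of equal length; it defines a partial map sending each level except the top one to the next level by translation. Start with the column $C_0=\{B_0\}$, $B_0=[0,1)$, of height $h_0=1$. Given $C_n=\{B_n,T(B_n),\dots,T^{h_n-1}(B_n)\}$, cut each level into $r_n$ subintervals of equal length (ordered left to right), giving subcolumns $0,\dots,r_n-1$; place $s_n(i)$ new disjoint intervals (spacers) of the same length on top of the $i$-th subcolumn; stack subcolumn $i+1$ on top of subcolumn $i$ for each $i$, to obtain $C_{n+1}$, of height $h_{n+1}=r_nh_n+\sum_{i=0}^{r_n-1}s_n(i)$ and base $B_{n+1}$ equal to the leftmost subinterval of $B_n$. The space $X$ is the union of all levels of all columns, with Lebesgue measure $\mu$, and $T$ is the a.e.-defined limit of the partial maps; it is an invertible measure-preserving ergodic transformation, called the rank-one transformation with parameters $(r_n),(s_n)$. Rank-one words. If $s_n(r_n-1)=0$ for all $n$ (no spacers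 on the final subcolumn), the associated rank-one words are $w_0=0$ and $w_{n+1}=w_n1^{s_n(0)}w_n1^{s_n(1)}\cdots 1^{s_n(r_n-2)}w_n$ (with $r_n$ copies of $w_n$), and $|w_n|$ denotes the length of $w_n$. Partially bounded. A rank-one transformation $T$ is partially bounded if it admits cutting and spacer parameters $(r_n),(s_n)$ with $s_n(r_n-1)=0$ for all $n$, and there are integers $\mathfrak{R}>0$, $\mathfrak{S}>0$ and $N_0$ such that for all $n\ge N_0$: (1) $r_n<\mathfrak{R}$; (2) $|s_n(i)-s_n(j)|<\mathfrak{S}$ for $0\le i,j<r_n-1$; (3) $s_n(i)\ge |w_n|$ for $0\le i<r_n-1$. Centralizer. $C(T)$ is the set of all invertible measure-preserving transformations of $X$ commuting with $T$ (a.e.). *)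

theory Defs
  imports "HOL-Analysis.Analysis"
begin

section \<open>Transformations of a measure space modulo null sets\<close>

definition ae_inverse :: "'a measure \<Rightarrow> ('a \<Rightarrow> 'a) \<Rightarrow> ('a \<Rightarrow> 'a) \<Rightarrow> bool" where
  "ae_inverse M S U \<longleftrightarrow>
     U \<in> measurable M M \<and> (AE x in M. U (S x) = x) \<and> (AE x in M. S (U x) = x)"

definition invertible_measure_preserving :: "'a measure \<Rightarrow> ('a \<Rightarrow> 'a) \<Rightarrow> bool" where
  "invertible_measure_preserving M S \<longleftrightarrow>
     S \<in> measurable M M \<and> distr M M S = M \<and> (\<exists>U. ae_inverse M S U)"

definition centralizer :: "'a measure \<Rightarrow> ('a \<Rightarrow> 'a) \<Rightarrow> ('a \<Rightarrow> 'a) set" where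
  "centralizer M T =
     {S. invertible_measure_preserving M S \<and> (AE x in M. S (T x) = T (S x))}"

text \<open>
  Integer powers of a transformation that is invertible modulo null sets. For invertible
  measure-preserving \<open>T\<close> the almost everywhere inverse is unique up to null sets, so the choice
  below is immaterial almost everywhere.
\<close>

definition ae_power :: "'a measure \<Rightarrow> ('a \<Rightarrow> 'a) \<Rightarrow> int \<Rightarrow> 'a \<Rightarrow> 'a" where
  "ae_power M T k =
     (if 0 \<le> k then T ^^ nat k else (SOME U. ae_inverse M T U) ^^ nat (- k))"

section \<open>Cutting and stacking\<close>

text \<open>
  \<open>r n\<close> is the number of pieces into which the column \<open>C\<^sub>n\<close> is cut, and \<open>s n i\<close>
  (relevant for \<open>i < r n\<close> only) is the number of spacers put on subcolumn \<open>i\<close>.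
\<close>

primrec col_height :: "(nat \<Rightarrow> nat) \<Rightarrow> (nat \<Rightarrow> nat \<Rightarrow> nat) \<Rightarrow> nat \<Rightarrow> nat" where
  "col_height r s 0 = 1"
| "col_height r s (Suc n) = r n * col_height r s n + (\<Sum>i<r n. s n i)"

primrec level_width :: "(nat \<Rightarrow> nat) \<Rightarrow> nat \<Rightarrow> real" where
  "level_width r 0 = 1"
| "level_width r (Suc n) = level_width r n / real (r n)"

text \<open>The index, in the column \<open>C\<^sub>n\<^sub>+\<^sub>1\<close>, of the bottom level of the \<open>i\<close>-th subcolumn of \<open>C\<^sub>n\<close>.\<close>

definition subcol_start :: "(nat \<Rightarrow> nat) \<Rightarrow> (nat \<Rightarrow> nat \<Rightarrow> nat) \<Rightarrow> nat \<Rightarrow> nat \<Rightarrow> nat" where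
  "subcol_start r s n i = i * col_height r s n + (\<Sum>k<i. s n k)"

text \<open>
  A column is recorded by the left endpoints of its levels: \<open>a n j\<close> is the left endpoint of the
  level \<open>T\<^sup>j(B\<^sub>n)\<close> of \<open>C\<^sub>n\<close>.
\<close>

definition level :: "(nat \<Rightarrow> nat) \<Rightarrow> (nat \<Rightarrow> nat \<Rightarrow> real) \<Rightarrow> nat \<Rightarrow> nat \<Rightarrow> real set" where
  "level r a n j = {a n j ..< a n j + level_width r n}"

text \<open>
  The spacers may be placed anywhere on the real line: the indices of \<open>C\<^sub>n\<^sub>+\<^sub>1\<close> that are not of the
  form \<open>subcol_start r s n i + j\<close> with \<open>j < col_height r s n\<close> belong to spacers, and their
  endpoints are constrained only by disjointness. As the levels of \<open>C\<^sub>n\<close> are unions of levels of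
  \<open>C\<^sub>n\<^sub>+\<^sub>1\<close>, disjointness of the levels of \<open>C\<^sub>n\<^sub>+\<^sub>1\<close> says that the spacers are disjoint from each
  other and from everything in \<open>C\<^sub>n\<close>.
\<close>

definition cutting_and_stacking ::
    "(nat \<Rightarrow> nat) \<Rightarrow> (nat \<Rightarrow> nat \<Rightarrow> nat) \<Rightarrow> (nat \<Rightarrow> nat \<Rightarrow> real) \<Rightarrow> bool" where
  "cutting_and_stacking r s a \<longleftrightarrow>
     (\<forall>n. 2 \<le> r n) \<and>
     a 0 0 = 0 \<and>
     (\<forall>n. \<forall>i<r n. \<forall>j<col_height r s n.
        a (Suc n) (subcol_start r s n i + j) = a n j + real i * level_width r (Suc n)) \<and>
     (\<forall>n. disjoint_family_on (level r a n) {..<col_height r s n})"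

definition columns_union ::
    "(nat \<Rightarrow> nat) \<Rightarrow> (nat \<Rightarrow> nat \<Rightarrow> nat) \<Rightarrow> (nat \<Rightarrow> nat \<Rightarrow> real) \<Rightarrow> real set" where
  "columns_union r s a = (\<Union>n. \<Union>j<col_height r s n. level r a n j)"

text \<open>
  The partial map of \<open>C\<^sub>n\<close> translates level \<open>j\<close> onto level \<open>j + 1\<close>. These maps extend one another
  and their domains cover the space up to a null set, so requiring \<open>T\<close> to extend all of them
  almost everywhere determines \<open>T\<close> almost everywhere as their limit.
\<close>

definition rank_one ::
    "(nat \<Rightarrow> nat) \<Rightarrow> (nat \<Rightarrow> nat \<Rightarrow> nat) \<Rightarrow> real set \<Rightarrow> (real \<Rightarrow> real) \<Rightarrow> bool" where
  "rank_one r s X T \<longleftrightarrow>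
     (\<exists>a. cutting_and_stacking r s a \<and> X = columns_union r s a \<and> T \<in> X \<rightarrow> X \<and>
        (AE x in lebesgue_on X. \<forall>n j. Suc j < col_height r s n \<and> x \<in> level r a n j \<longrightarrow>
           T x = x + (a n (Suc j) - a n j)))"

section \<open>Partial boundedness\<close>

primrec rank_one_word :: "(nat \<Rightarrow> nat) \<Rightarrow> (nat \<Rightarrow> nat \<Rightarrow> nat) \<Rightarrow> nat \<Rightarrow> nat list" where
  "rank_one_word r s 0 = [0]"
| "rank_one_word r s (Suc n) =
     concat (map (\<lambda>i. rank_one_word r s n @ replicate (s n i) 1) [0..<r n - 1])
       @ rank_one_word r s n"

definition partially_bounded :: "real set \<Rightarrow> (real \<Rightarrow> real) \<Rightarrow> bool" where
  "partially_bounded X T \<longleftrightarrow>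
     (\<exists>r s. rank_one r s X T \<and> (\<forall>n. s n (r n - 1) = 0) \<and>
        (\<exists>(R::int) (S::int) (N\<^sub>0::nat). R > 0 \<and> S > 0 \<and>
           (\<forall>n\<ge>N\<^sub>0.
              int (r n) < R \<and>
              (\<forall>i<r n - 1. \<forall>j<r n - 1. \<bar>int (s n i) - int (s n j)\<bar> < S) \<and>
              (\<forall>i<r n - 1. s n i \<ge> length (rank_one_word r s n)))))"

end

theory Submission
  imports Defs
begin

text \<open>
  Cutting \<open>C\<^sub>n\<close> into subcolumns gives every point a sequence of digits: the index of the subcolumn
  of \<open>C\<^sub>n\<close> that contains it. Its position in \<open>C\<^sub>n\<^sub>+\<^sub>1\<close> is its position in \<open>C\<^sub>n\<close> plus the start of
  that subcolumn. Let \<open>\<Phi>\<close> commute with \<open>T\<close> and let \<open>x\<close> be in the unit interval \<open>B\<^sub>0\<close>. If \<open>x\<close> and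
  \<open>\<Phi> x\<close> have the same digits from some \<open>n\<close> on, the difference \<open>d\<close> of their positions does not
  change any more, and since the levels shrink to points, \<open>\<Phi> x = T\<^sup>d x\<close>
  (\<open>same_subcolumns_imp_shift\<close>). So the heart of the matter is that for almost every \<open>x\<close> the
  digits differ only finitely often.

  Suppose that \<open>x\<close> is in subcolumn \<open>i\<close> of \<open>C\<^sub>n\<close> and \<open>\<Phi> x\<close> is in subcolumn \<open>l > i\<close>. Apply to both
  points the power of \<open>T\<close> that takes subcolumn \<open>i\<close> to subcolumn \<open>i + (r\<^sub>n - l)\<close>. The first point
  returns to the same level of \<open>C\<^sub>n\<close>, hence to \<open>B\<^sub>0\<close>. The second one has only \<open>r\<^sub>n - l - 1\<close>
  subcolumns above it, and as the spacers of \<open>C\<^sub>n\<close> are nearly equal, it is pushed out of \<open>C\<^sub>n\<^sub>+\<^sub>1\<close>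
  through the top; up to a constant, the time since its last visit lies between \<open>h\<^sub>n\<close> and
  \<open>h\<^sub>n\<^sub>+\<^sub>1\<close>. For large \<open>n\<close> it cannot have come back, because the gaps between copies of a column
  are at least as long as the column itself. So the time since it left tells \<open>n\<close>. The sets of such
  exit points are therefore disjoint for different \<open>n\<close> (\<open>exit_regions_disjoint\<close>), and so are the
  subsets of \<open>B\<^sub>0\<close> that \<open>\<Phi>\<close> maps to them; the measures of the latter add up to at most 1. Since
  powers of \<open>T\<close> preserve measure, for fixed \<open>i\<close> and \<open>l\<close> the sets of points \<open>x\<close> with the digits \<open>i\<close>
  and \<open>l\<close> at \<open>n\<close> have summable measure, and the lemma of Borel and Cantelli applies
  (\<open>eventually_not_split\<close>). For \<open>l < i\<close> one moves backwards, and the second point leaves through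
  the bottom. As the cutting parameters are bounded, only finitely many pairs \<open>i\<close>, \<open>l\<close> occur.

  Hence \<open>\<Phi> x = T\<^sup>d x\<close> almost everywhere on \<open>B\<^sub>0\<close>, with \<open>d\<close> depending on \<open>x\<close>. The set of all \<open>x\<close>
  that have a given \<open>d\<close> is invariant, and by ergodicity (\<open>shift_ergodic\<close>) one of these sets has
  full measure.

  Powers of \<open>T\<close> are replaced throughout by the maps \<open>shift k\<close>, which move a point \<open>k\<close> levels up in
  any column that is high enough. On the set \<open>Core\<close> they form an honest action of the integers;
  the null sets are dealt with once, by passing to invariant subsets of full measure
  (\<open>shift_invariant_conull_subset\<close>).
\<close>

section \<open>Lebesgue measure and maps preserving it\<close>

lemma piecewise_translation_preserves_measure:
  fixes f :: "real \<Rightarrow> real" and Q :: "nat \<Rightarrow> real set" and c :: "nat \<Rightarrow> real"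
  assumes E: "E \<in> sets lebesgue" and Q: "\<And>i. Q i \<in> sets lebesgue"
    and cover: "E \<subseteq> (\<Union>i. Q i)" and inj: "inj_on f E"
    and f: "\<And>i x. x \<in> E \<Longrightarrow> x \<in> Q i \<Longrightarrow> f x = x + c i"
  shows "f ` E \<in> sets lebesgue \<and> emeasure lebesgue (f ` E) = emeasure lebesgue E"
proof -
  define D where "D i = E \<inter> disjointed Q i" for i
  have D_sets: "D i \<in> sets lebesgue" for i
    using E Q sets.range_disjointed_sets[of Q lebesgue] unfolding D_def by auto
  have D_sub: "D i \<subseteq> E \<inter> Q i" for i
    unfolding D_def using disjointed_subset[of Q i] by blast
  have D_disj: "disjoint_family D"
    using disjoint_family_disjointed[of Q] unfolding D_def disjoint_family_on_def by blast
  have D_Un: "(\<Union>i. D i) = E"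
    using cover UN_disjointed_eq[of Q] unfolding D_def by blast
  have img: "f ` D i = (+) (c i) ` D i" for i
    using D_sub[of i] f by (intro image_cong) (auto simp: add.commute)
  have img_sets: "f ` D i \<in> sets lebesgue" for i
    unfolding img using D_sets by (rule lebesgue_sets_translation)
  have img_meas: "emeasure lebesgue (f ` D i) = emeasure lebesgue (D i)" for i
    using emeasure_lebesgue_affine[of 1 "c i" "D i"] unfolding img by (simp add: add.commute)
  have img_disj: "disjoint_family (\<lambda>i. f ` D i)"
    unfolding disjoint_family_on_def
  proof (intro ballI impI)
    fix i j :: nat assume "i \<noteq> j"
    then have "D i \<inter> D j = {}" using D_disj by (auto simp: disjoint_family_on_def)
    moreover have "f ` D i \<inter> f ` D j = f ` (D i \<inter> D j)"
      using inj_on_image_Int[OF inj, of "D i" "D j"] D_sub by blast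
    ultimately show "f ` D i \<inter> f ` D j = {}" by simp
  qed
  have "f ` E = (\<Union>i. f ` D i)" using D_Un by blast
  moreover have "(\<Sum>i. emeasure lebesgue (f ` D i)) = emeasure lebesgue (\<Union>i. f ` D i)"
    by (rule suminf_emeasure[OF _ img_disj]) (use img_sets in auto)
  moreover have "(\<Sum>i. emeasure lebesgue (D i)) = emeasure lebesgue (\<Union>i. D i)"
    by (rule suminf_emeasure[OF _ D_disj]) (use D_sets in auto)
  ultimately show ?thesis using img_sets img_meas D_Un by auto
qed

lemma Int_interval_lmeasurable:
  fixes A :: "real set"
  assumes "A \<in> sets lebesgue"
  shows "A \<inter> {x..<y} \<in> lmeasurable"
  by (rule fmeasurableI2[of "{x..y}"]) (use assms in auto)

lemma interval_lmeasurable: "{x..<y::real} \<in> lmeasurable"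
  using Int_interval_lmeasurable[of UNIV x y] by simp

lemma AE_lebesgue_on_null_set:
  assumes "AE x in lebesgue_on X. P x" "X \<in> sets lebesgue"
  obtains N where "N \<in> null_sets lebesgue" "\<And>x. x \<in> X - N \<Longrightarrow> P x"
proof -
  obtain N where "\<And>x. x \<in> space (lebesgue_on X) - N \<Longrightarrow> P x" "N \<in> null_sets (lebesgue_on X)"
    using AE_E3[OF assms(1)] by blast
  then show ?thesis using that[of N] assms(2) by (auto simp: null_sets_restrict_space)
qed

lemma AE_lebesgue_onI:
  assumes "X - G \<in> null_sets lebesgue" "X \<in> sets lebesgue" "\<And>x. x \<in> G \<Longrightarrow> P x"
  shows "AE x in lebesgue_on X. P x"
proof (rule AE_I')
  show "X - G \<in> null_sets (lebesgue_on X)" using assms by (simp add: null_sets_restrict_space)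
  show "{x \<in> space (lebesgue_on X). \<not> P x} \<subseteq> X - G" using assms(3) by auto
qed

lemma measure_preserving_vimage:
  assumes X: "X \<in> sets lebesgue" and \<Phi>: "\<Phi> \<in> measurable (lebesgue_on X) (lebesgue_on X)"
    and distr: "distr (lebesgue_on X) (lebesgue_on X) \<Phi> = lebesgue_on X"
    and B: "B \<in> sets lebesgue" "B \<subseteq> X"
  shows "\<Phi> -` B \<inter> X \<in> sets lebesgue" "emeasure lebesgue (\<Phi> -` B \<inter> X) = emeasure lebesgue B"
proof -
  have BX: "B \<in> sets (lebesgue_on X)" using B X by (simp add: sets_restrict_space_iff)
  have "\<Phi> -` B \<inter> space (lebesgue_on X) \<in> sets (lebesgue_on X)" using \<Phi> BX by (rule measurable_sets)
  then show *: "\<Phi> -` B \<inter> X \<in> sets lebesgue" using X by (simp add: sets_restrict_space_iff)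
  have "emeasure lebesgue B = emeasure (lebesgue_on X) B"
    using X B by (simp add: emeasure_restrict_space)
  also have "\<dots> = emeasure (distr (lebesgue_on X) (lebesgue_on X) \<Phi>) B" by (simp only: distr)
  also have "\<dots> = emeasure (lebesgue_on X) (\<Phi> -` B \<inter> X)"
    using \<Phi> BX by (simp add: emeasure_distr)
  also have "\<dots> = emeasure lebesgue (\<Phi> -` B \<inter> X)"
    using X by (simp add: emeasure_restrict_space)
  finally show "emeasure lebesgue (\<Phi> -` B \<inter> X) = emeasure lebesgue B" by simp
qed

text \<open>
  The lemma of Borel and Cantelli, with summability supplied by disjoint sets of at least the same
  measure that all lie in one set of finite measure.
\<close>

lemma eventually_avoids_dominated_sets:
  assumes A: "\<And>n. A n \<in> sets M" and E: "\<And>n. E n \<in> sets M" "disjoint_family E" "\<And>n. E n \<subseteq> B"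
    and B: "B \<in> sets M" "emeasure M B < \<infinity>"
    and le: "\<And>n. emeasure M (A n) \<le> emeasure M (E n)"
  shows "AE x in M. eventually (\<lambda>n. x \<notin> A n) sequentially"
proof -
  have E_fin: "emeasure M (E n) < \<infinity>" for n
    using emeasure_mono[OF E(3) B(1)] B(2) by (rule le_less_trans)
  have A_fin: "emeasure M (A n) < \<infinity>" for n
    using le E_fin by (rule le_less_trans)
  have E_real: "emeasure M (E n) = ennreal (measure M (E n))" for n
    using E_fin[of n] by (intro emeasure_eq_ennreal_measure) auto
  have "(\<Sum>n. emeasure M (E n)) = emeasure M (\<Union>n. E n)"
    by (rule suminf_emeasure) (use E in auto)
  also have "\<dots> \<le> emeasure M B" using E(3) B(1) by (intro emeasure_mono) auto
  finally have "(\<Sum>n. emeasure M (E n)) < \<infinity>" using B(2) by (rule le_less_trans)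
  then have "(\<Sum>n. ennreal (measure M (E n))) \<noteq> top" unfolding E_real by simp
  then have E_sum: "summable (\<lambda>n. measure M (E n))" by (rule summable_suminf_not_top[rotated]) simp
  have le': "measure M (A n) \<le> measure M (E n)" for n
    unfolding measure_def by (rule enn2real_mono[OF le]) (use E_fin in simp)
  have A_sum: "summable (\<lambda>n. measure M (A n))"
    by (rule summable_comparison_test'[OF E_sum, where N=0]) (use le' in simp)
  from borel_cantelli_AE1[OF A A_fin A_sum] show ?thesis
  proof (rule AE_mp, intro AE_I2 impI)
    fix x assume "eventually (\<lambda>n. x \<in> space M - A n) sequentially"
    then show "eventually (\<lambda>n. x \<notin> A n) sequentially" by (rule eventually_mono) simp
  qed
qed

section \<open>The geometry of the columns\<close>

locale stacked_columns =
  fixes r :: "nat \<Rightarrow> nat" and s :: "nat \<Rightarrow> nat \<Rightarrow> nat" and a :: "nat \<Rightarrow> nat \<Rightarrow> real"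
  assumes stacking: "cutting_and_stacking r s a"
begin

abbreviation h :: "nat \<Rightarrow> nat" where "h \<equiv> col_height r s"
abbreviation w :: "nat \<Rightarrow> real" where "w \<equiv> level_width r"
abbreviation L :: "nat \<Rightarrow> nat \<Rightarrow> real set" where "L \<equiv> level r a"
abbreviation start :: "nat \<Rightarrow> nat \<Rightarrow> nat" where "start \<equiv> subcol_start r s"
abbreviation X :: "real set" where "X \<equiv> columns_union r s a"

lemma r_ge_2: "2 \<le> r n"
  using stacking unfolding cutting_and_stacking_def by blast

lemma r_pos: "0 < r n"
  using r_ge_2[of n] by linarith

lemma endpoint_Suc:
  "i < r n \<Longrightarrow> j < h n \<Longrightarrow> a (Suc n) (start n i + j) = a n j + real i * w (Suc n)"
  using stacking unfolding cutting_and_stacking_def by blast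

lemma level_0: "L 0 0 = {0..<1}"
  using stacking unfolding cutting_and_stacking_def level_def by auto

lemma level_unique: "x \<in> L n p \<Longrightarrow> x \<in> L n q \<Longrightarrow> p < h n \<Longrightarrow> q < h n \<Longrightarrow> p = q"
  using stacking unfolding cutting_and_stacking_def disjoint_family_on_def by blast

lemma level_sets: "L n j \<in> sets borel" "L n j \<in> sets lebesgue"
  unfolding level_def by auto

lemma w_pos: "0 < w n"
  using r_pos by (induction n) auto

lemma w_Suc: "real (r n) * w (Suc n) = w n"
  using r_pos[of n] by simp

lemma w_le_power: "w n \<le> (1 / 2) ^ n"
proof (induction n)
  case (Suc n)
  have "w (Suc n) \<le> w n / 2"
    using r_ge_2[of n] w_pos[of n] unfolding level_width.simps by (intro divide_left_mono) auto
  also have "\<dots> \<le> (1 / 2) ^ n / 2" using Suc by simp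
  finally show ?case by simp
qed simp

lemma w_small: assumes "0 < e" shows "\<exists>n\<ge>N. w n < e"
proof -
  have "(\<lambda>n. (1 / 2 :: real) ^ n) \<longlonglongrightarrow> 0" by (rule LIMSEQ_power_zero) simp
  then have "eventually (\<lambda>n. (1 / 2 :: real) ^ n < e) sequentially"
    using assms by (rule order_tendstoD(2))
  then obtain m where m: "\<And>n. n \<ge> m \<Longrightarrow> (1 / 2 :: real) ^ n < e"
    unfolding eventually_sequentially by blast
  then have "w (max m N) < e" using w_le_power[of "max m N"] by (meson le_less_trans max.cobounded1)
  then show ?thesis by (intro exI[of _ "max m N"]) auto
qed

lemma emeasure_level: "emeasure lebesgue (L n j) = ennreal (w n)"
  unfolding level_def using w_pos[of n] by simp

lemma start_0 [simp]: "start n 0 = 0"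
  by (simp add: subcol_start_def)

lemma start_Suc: "start n (Suc i) = start n i + h n + s n i"
  by (simp add: subcol_start_def)

lemma start_r: "start n (r n) = h (Suc n)"
  by (simp add: subcol_start_def)

lemma start_mono: "i \<le> j \<Longrightarrow> start n i \<le> start n j"
  by (induction rule: dec_induct) (auto simp: start_Suc)

lemma start_add_less:
  assumes "i < r n" "j < h n"
  shows "start n i + j < h (Suc n)"
proof -
  have "start n i + h n \<le> start n (Suc i)" by (simp add: start_Suc)
  also have "\<dots> \<le> h (Suc n)" using start_mono[of "Suc i" "r n" n] assms by (simp add: start_r)
  finally show ?thesis using assms by simp
qed

lemma h_Suc_ge: "2 * h n \<le> h (Suc n)"
proof -
  have "2 * h n \<le> r n * h n" using r_ge_2[of n] by (rule mult_le_mono1)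
  then show ?thesis unfolding col_height.simps by linarith
qed

lemma h_pos: "0 < h n"
proof (induction n)
  case (Suc n)
  then show ?case using h_Suc_ge[of n] by linarith
qed simp

lemma h_mono: "m \<le> n \<Longrightarrow> h m \<le> h n"
proof (induction rule: dec_induct)
  case (step n)
  then show ?case using h_Suc_ge[of n] by linarith
qed simp

lemma h_gt: "n < h n"
proof (induction n)
  case (Suc n)
  then show ?case using h_Suc_ge[of n] by linarith
qed simp

lemma sublevel:
  assumes "i < r n" "j < h n"
  shows "L (Suc n) (start n i + j) \<subseteq> L n j"
proof
  fix x assume "x \<in> L (Suc n) (start n i + j)"
  then have 1: "a n j + real i * w (Suc n) \<le> x" "x < a n j + real i * w (Suc n) + w (Suc n)"
    unfolding level_def endpoint_Suc[OF assms] by auto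
  have "real (Suc i) * w (Suc n) \<le> real (r n) * w (Suc n)"
    using assms w_pos[of "Suc n"] by (intro mult_right_mono) auto
  then have "real i * w (Suc n) + w (Suc n) \<le> w n" unfolding w_Suc by (simp add: algebra_simps del: level_width.simps)
  moreover have "0 \<le> real i * w (Suc n)" using w_pos[of "Suc n"]
    by (intro mult_nonneg_nonneg) (auto simp del: level_width.simps)
  ultimately have "a n j \<le> x" "x < a n j + w n" using 1 by linarith+
  then show "x \<in> L n j" unfolding level_def by auto
qed

lemma sublevel_exists:
  assumes "x \<in> L n j" "j < h n"
  obtains i where "i < r n" "x \<in> L (Suc n) (start n i + j)"
proof -
  define t where "t = (x - a n j) / w (Suc n)"
  have wp: "0 < w (Suc n)" by (rule w_pos)
  have x: "a n j \<le> x" "x < a n j + real (r n) * w (Suc n)"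
    using assms(1) unfolding level_def w_Suc by auto
  have t: "0 \<le> t" "t < real (r n)"
    unfolding t_def using x wp by (auto simp: pos_divide_less_eq simp del: level_width.simps)
  define i where "i = nat \<lfloor>t\<rfloor>"
  have ir: "i < r n" and it: "real i \<le> t" "t < real i + 1"
    using t unfolding i_def by linarith+
  have "real i * w (Suc n) \<le> x - a n j" "x - a n j < (real i + 1) * w (Suc n)"
    using it wp unfolding t_def
    by (auto simp: pos_le_divide_eq pos_divide_less_eq simp del: level_width.simps)
  then have "x \<in> L (Suc n) (start n i + j)"
    unfolding level_def endpoint_Suc[OF ir assms(2)]
    by (simp add: algebra_simps del: level_width.simps)
  with ir show ?thesis by (rule that)
qed

text \<open>
  A level of \<open>C\<^sub>m\<close> lies in a copy of \<open>C\<^sub>m\<close> inside \<open>C\<^sub>n\<close>. The last two conclusions say that this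
  copy starts at height \<open>p - q\<close> and ends within \<open>C\<^sub>n\<close>.
\<close>

lemma level_refine:
  assumes "m \<le> n" "x \<in> L m q" "q < h m"
  obtains p where "p < h n" "x \<in> L n p" "L n p \<subseteq> L m q" "q \<le> p" "p - q + h m \<le> h n"
proof -
  have "\<exists>p<h n. x \<in> L n p \<and> L n p \<subseteq> L m q \<and> q \<le> p \<and> p - q + h m \<le> h n" using assms(1)
  proof (induction rule: dec_induct)
    case base
    then show ?case using assms by auto
  next
    case (step n)
    then obtain p where p: "p < h n" "x \<in> L n p" "L n p \<subseteq> L m q" "q \<le> p" "p - q + h m \<le> h n"
      by blast
    obtain i where i: "i < r n" "x \<in> L (Suc n) (start n i + p)"
      using sublevel_exists[OF p(2,1)] .
    have "start n i + h n \<le> h (Suc n)" using start_add_less[OF i(1), of "h n - 1"] h_pos[of n] by simp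
    then show ?case
      using start_add_less[OF i(1) p(1)] i(2) sublevel[OF i(1) p(1)] p
      by (intro exI[of _ "start n i + p"]) auto
  qed
  then show ?thesis using that by blast
qed

lemma X_iff: "x \<in> X \<longleftrightarrow> (\<exists>n. \<exists>j<h n. x \<in> L n j)"
  unfolding columns_union_def by auto

lemma X_sets: "X \<in> sets lebesgue"
  unfolding columns_union_def using level_sets by auto

section \<open>Integer powers of the transformation as shifts along columns\<close>

text \<open>
  The graph of the power \<open>q - p\<close> of the transformation, as far as the column \<open>C\<^sub>n\<close> defines it. The
  columns extend one another, so only the difference of the positions matters (\<open>moves_refine\<close>,
  \<open>moves_unique\<close>), which makes the definition of \<open>shift\<close> below meaningful.
\<close>

definition moves :: "nat \<Rightarrow> nat \<Rightarrow> nat \<Rightarrow> real \<Rightarrow> real \<Rightarrow> bool" where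
  "moves n p q x y \<longleftrightarrow> p < h n \<and> q < h n \<and> x \<in> L n p \<and> y = x + (a n q - a n p)"

lemma moves_levels: "moves n p q x y \<Longrightarrow> x \<in> L n p \<and> y \<in> L n q"
  unfolding moves_def level_def by auto

lemma moves_refine:
  assumes "m \<le> n" "moves m p q x y"
  obtains p' q' where "moves n p' q' x y" "int q' - int p' = int q - int p"
proof -
  have "\<exists>p' q'. moves n p' q' x y \<and> int q' - int p' = int q - int p" using assms(1)
  proof (induction rule: dec_induct)
    case base
    then show ?case using assms by auto
  next
    case (step n)
    then obtain p' q' where *: "moves n p' q' x y" "int q' - int p' = int q - int p" by blast
    then have b: "p' < h n" "q' < h n" "x \<in> L n p'" "y = x + (a n q' - a n p')"
      unfolding moves_def by auto
    obtain i where i: "i < r n" "x \<in> L (Suc n) (start n i + p')"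
      using sublevel_exists[OF b(3,1)] .
    have "moves (Suc n) (start n i + p') (start n i + q') x y"
      unfolding moves_def endpoint_Suc[OF i(1) b(1)] endpoint_Suc[OF i(1) b(2)]
      using start_add_less[OF i(1) b(1)] start_add_less[OF i(1) b(2)] i(2) b(4) by simp
    then show ?case
      using *(2) by (intro exI[of _ "start n i + p'"] exI[of _ "start n i + q'"]) simp
  qed
  then show ?thesis using that by blast
qed

lemma moves_unique:
  assumes "moves n p q x y" "moves n' p' q' x y'" "int q - int p = int q' - int p'"
  shows "y = y'"
proof -
  let ?N = "max n n'"
  obtain p1 q1 where 1: "moves ?N p1 q1 x y" "int q1 - int p1 = int q - int p"
    using moves_refine[OF _ assms(1), of ?N] by auto
  obtain p2 q2 where 2: "moves ?N p2 q2 x y'" "int q2 - int p2 = int q' - int p'"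
    using moves_refine[OF _ assms(2), of ?N] by auto
  have "p1 = p2" using 1(1) 2(1) level_unique[of x ?N p1 p2] unfolding moves_def by auto
  then have "q1 = q2" using 1(2) 2(2) assms(3) by linarith
  with \<open>p1 = p2\<close> show ?thesis using 1(1) 2(1) unfolding moves_def by simp
qed

definition shift :: "int \<Rightarrow> real \<Rightarrow> real" where
  "shift k x = (THE y. \<exists>n p q. moves n p q x y \<and> int q - int p = k)"

lemma shift_eq:
  assumes "moves n p q x y" "int q - int p = k"
  shows "shift k x = y"
  unfolding shift_def
proof (rule the_equality)
  show "\<exists>n p q. moves n p q x y \<and> int q - int p = k" using assms by blast
  fix z assume "\<exists>n p q. moves n p q x z \<and> int q - int p = k"
  then show "z = y" using moves_unique assms by blast
qed

lemma shift_moves: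
  assumes "x \<in> L n p" "p < h n" "q < h n" "int q - int p = k"
  shows "moves n p q x (shift k x)"
proof -
  have "moves n p q x (x + (a n q - a n p))" using assms unfolding moves_def by simp
  then show ?thesis using shift_eq[OF _ assms(4)] by metis
qed

lemma shift_level:
  assumes "x \<in> L n p" "p < h n" "q < h n" "int q - int p = k"
  shows "shift k x \<in> L n q"
  using moves_levels[OF shift_moves[OF assms]] by simp

lemma shift_translation:
  assumes "x \<in> L n p" "p < h n" "q < h n" "int q - int p = k"
  shows "shift k x = x + (a n q - a n p)"
  using shift_moves[OF assms] unfolding moves_def by simp

text \<open>
  Membership asks for a column in which the point is at distance at least \<open>K\<close> from both ends, for
  every \<open>K\<close>, so that every power of the transformation is defined at the point by some column.
\<close>

definition Core :: "real set" where
  "Core = {x. \<forall>K. \<exists>n p. K \<le> p \<and> p + K < h n \<and> x \<in> L n p}"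

lemma deep_refine:
  assumes "m \<le> n" "K \<le> p" "p + K < h m" "x \<in> L m p"
  obtains q where "K \<le> q" "q + K < h n" "x \<in> L n q"
proof -
  obtain q where "q < h n" "x \<in> L n q" "L n q \<subseteq> L m p" "p \<le> q" "q - p + h m \<le> h n"
    by (rule level_refine[OF assms(1,4)]) (use assms in auto)
  then show ?thesis using that[of q] assms by auto
qed

lemma Core_deep:
  assumes "x \<in> Core"
  obtains n p where "N \<le> n" "K \<le> p" "p + K < h n" "x \<in> L n p"
proof -
  obtain m p where "K \<le> p" "p + K < h m" "x \<in> L m p" using assms unfolding Core_def by blast
  then obtain q where "K \<le> q" "q + K < h (max m N)" "x \<in> L (max m N) q"
    using deep_refine[of m "max m N" K p x] by auto
  then show ?thesis using that[of "max m N" q] by auto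
qed

lemma Core_shift:
  assumes "x \<in> Core"
  obtains n p q where "N \<le> n" "K \<le> p" "p + K < h n" "K \<le> q" "q + K < h n" "x \<in> L n p"
    "int q - int p = k" "moves n p q x (shift k x)"
proof -
  let ?J = "K + nat \<bar>k\<bar>"
  obtain n p where np: "N \<le> n" "?J \<le> p" "p + ?J < h n" "x \<in> L n p"
    by (rule Core_deep[OF assms])
  define q where "q = nat (int p + k)"
  have q: "int q - int p = k" "K \<le> q" "q + K < h n" using np unfolding q_def by linarith+
  show ?thesis
    by (rule that[of n p q]) (use np q shift_moves[of x n p q k] in auto)
qed

lemma Core_subset_X: "Core \<subseteq> X"
proof
  fix x assume "x \<in> Core"
  then obtain n p where "p + 0 < h n" "x \<in> L n p" by (rule Core_deep[where K=0]) auto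
  then show "x \<in> X" unfolding X_iff by auto
qed

lemma shift_in_Core:
  assumes "x \<in> Core"
  shows "shift k x \<in> Core"
  unfolding Core_def
proof (intro CollectI allI)
  fix K
  obtain n p q where "K \<le> q" "q + K < h n" "moves n p q x (shift k x)"
    using assms by (rule Core_shift[where k=k and K=K])
  then show "\<exists>n p. K \<le> p \<and> p + K < h n \<and> shift k x \<in> L n p"
    using moves_levels by blast
qed

lemma shift_shift:
  assumes "x \<in> Core"
  shows "shift l (shift k x) = shift (k + l) x"
proof -
  obtain n p q where n: "nat \<bar>l\<bar> \<le> q" "q + nat \<bar>l\<bar> < h n" "moves n p q x (shift k x)"
    "int q - int p = k" "p + nat \<bar>l\<bar> < h n" "x \<in> L n p"
    using assms by (rule Core_shift[where k=k and K="nat \<bar>l\<bar>"]) 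
  define u where "u = nat (int q + l)"
  have u: "int u - int q = l" "u < h n" using n unfolding u_def by linarith+
  have "shift l (shift k x) = shift k x + (a n u - a n q)"
    by (rule shift_translation) (use n u moves_levels in auto)
  moreover have "shift k x = x + (a n q - a n p)" using n unfolding moves_def by simp
  moreover have "shift (k + l) x = x + (a n u - a n p)"
    by (rule shift_translation) (use n u in auto)
  ultimately show ?thesis by simp
qed

lemma shift_0:
  assumes "x \<in> Core"
  shows "shift 0 x = x"
proof -
  obtain n p where "p + 0 < h n" "x \<in> L n p" using assms by (rule Core_deep[where K=0])
  then show ?thesis using shift_translation[of x n p p 0] by simp
qed

lemma shift_inverse: "x \<in> Core \<Longrightarrow> shift (-k) (shift k x) = x" "x \<in> Core \<Longrightarrow> shift k (shift (-k) x) = x"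
  by (simp_all add: shift_shift shift_0)

lemma shift_inj: "inj_on (shift k) Core"
  by (rule inj_on_inverseI[where g="shift (-k)"]) (simp add: shift_inverse)

text \<open>
  Images under a shift are preimages under its inverse; measurability of preimages thus comes from
  \<open>shift_preserves_measure\<close>.
\<close>

lemma shift_image_iff: 
  assumes "E \<subseteq> Core" "x \<in> Core"
  shows "x \<in> shift k ` E \<longleftrightarrow> shift (-k) x \<in> E"
proof
  assume "x \<in> shift k ` E"
  then show "shift (-k) x \<in> E" using assms by (auto simp: shift_inverse)
next
  assume "shift (-k) x \<in> E"
  then have "shift k (shift (-k) x) \<in> shift k ` E" by (rule imageI)
  then show "x \<in> shift k ` E" using assms by (simp add: shift_inverse)
qed

lemma Core_sets: "Core \<in> sets lebesgue"
proof -
  have "Core = (\<Inter>K. \<Union>n. \<Union>p\<in>{p. K \<le> p \<and> p + K < h n}. L n p)"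
    unfolding Core_def by auto
  also have "\<dots> \<in> sets lebesgue"
    by (intro sets.countable_INT' sets.countable_UN' ) (auto intro: level_sets)
  finally show ?thesis .
qed

text \<open>
  On each level from which \<open>C\<^sub>n\<close> defines it, a shift is a translation, and countably many such
  levels cover the core.
\<close>

lemma shift_preserves_measure:
  assumes "E \<in> sets lebesgue" "E \<subseteq> Core"
  shows "shift k ` E \<in> sets lebesgue" "emeasure lebesgue (shift k ` E) = emeasure lebesgue E"
proof -
  define dom where "dom z = (case z of (n, p) \<Rightarrow> p < h n \<and> 0 \<le> int p + k \<and> int p + k < int (h n))"
    for z :: "nat \<times> nat"
  define Q where "Q i = (if dom (from_nat i) then case_prod L (from_nat i) else {})" for i
  define c where "c i = (case from_nat i of (n, p) \<Rightarrow> a n (nat (int p + k)) - a n p)" for i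
  have "shift k ` E \<in> sets lebesgue \<and> emeasure lebesgue (shift k ` E) = emeasure lebesgue E"
  proof (rule piecewise_translation_preserves_measure[where Q=Q and c=c])
    show "Q i \<in> sets lebesgue" for i unfolding Q_def by (auto split: prod.split intro: level_sets)
    show "E \<subseteq> (\<Union>i. Q i)"
    proof
      fix x assume "x \<in> E"
      then have "x \<in> Core" using assms by auto
      then obtain n p q where n: "p + 0 < h n" "q + 0 < h n" "x \<in> L n p" "int q - int p = k"
        by (rule Core_shift[where k=k and K=0])
      then have "x \<in> Q (to_nat (n, p))" unfolding Q_def dom_def by auto
      then show "x \<in> (\<Union>i. Q i)" by blast
    qed
    show "inj_on (shift k) E" using shift_inj assms(2) by (rule inj_on_subset)
    fix i x assume "x \<in> Q i"
    then obtain n p where z: "from_nat i = (n, p)" "dom (n, p)" "x \<in> L n p"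
      unfolding Q_def by (metis case_prod_conv empty_iff surj_pair)
    then show "shift k x = x + c i"
      unfolding c_def using shift_translation[of x n p "nat (int p + k)" k] by (auto simp: dom_def)
  qed fact
  then show "shift k ` E \<in> sets lebesgue" "emeasure lebesgue (shift k ` E) = emeasure lebesgue E"
    by auto
qed

lemma shift_null:
  assumes "N \<in> null_sets lebesgue" "N \<subseteq> Core"
  shows "shift k ` N \<in> null_sets lebesgue"
  using assms shift_preserves_measure[of N k] by (auto simp: null_sets_def)

text \<open>
  A point outside the core that has entered the columns stays, for some \<open>K\<close>, within distance \<open>K\<close>
  of an end of every later column. The at most \<open>2 * K\<close> levels of \<open>C\<^sub>n\<close> that are so close to an end
  have total measure at most \<open>2 * K * w n\<close>, which tends to zero.
\<close>

lemma X_minus_Core_null: "X - Core \<in> null_sets lebesgue"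
proof -
  \<comment> \<open>The points that stay within distance \<open>K\<close> of the ends of all columns from \<open>C\<^sub>m\<close> on.\<close>
  define Z where "Z m K = (\<Inter>n\<in>{m..}. \<Union>p\<in>{p. p < h n \<and> (p < K \<or> h n \<le> p + K)}. L n p)" for m K
  have Z_sets: "Z m K \<in> sets lebesgue" for m K
    unfolding Z_def
    by (intro sets.countable_INT'' sets.countable_UN') (auto intro: level_sets)
  have "Z m K \<in> null_sets lebesgue" for m K
  proof -
    have bound: "emeasure lebesgue (Z m K) \<le> ennreal (2 * real K * w n)" if "m \<le> n" for n
    proof -
      let ?I = "{p. p < h n \<and> (p < K \<or> h n \<le> p + K)}"
      have "?I \<subseteq> {..<K} \<union> {h n - K..<h n}" by auto
      then have "card ?I \<le> card ({..<K} \<union> {h n - K..<h n})" by (intro card_mono) auto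
      also have "\<dots> \<le> card {..<K} + card {h n - K..<h n}" by (rule card_Un_le)
      also have "\<dots> \<le> 2 * K" by simp
      finally have card: "card ?I \<le> 2 * K" .
      have "emeasure lebesgue (Z m K) \<le> emeasure lebesgue (\<Union>p\<in>?I. L n p)"
        using that by (intro emeasure_mono) (auto simp: Z_def intro!: level_sets)
      also have "\<dots> \<le> (\<Sum>p\<in>?I. emeasure lebesgue (L n p))"
        by (rule emeasure_subadditive_finite) (auto intro: level_sets)
      also have "\<dots> = of_nat (card ?I) * ennreal (w n)" by (simp add: emeasure_level)
      also have "\<dots> \<le> of_nat (2 * K) * ennreal (w n)"
        using card by (intro mult_right_mono) (auto simp del: of_nat_mult)
      also have "\<dots> = ennreal (2 * real K * w n)"
        using w_pos[of n] by (simp add: ennreal_mult'' ennreal_of_nat_eq_real_of_nat)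
      finally show ?thesis .
    qed
    have "emeasure lebesgue (Z m K) \<le> ennreal e" if "e > 0" for e
    proof -
      obtain n where n: "m \<le> n" "w n < e / (2 * real K + 1)"
        using w_small[of "e / (2 * real K + 1)" m] \<open>e > 0\<close> by auto
      have "2 * real K * w n \<le> (2 * real K + 1) * w n"
        using w_pos[of n] by (intro mult_right_mono) auto
      also have "\<dots> \<le> e" using n(2) by (simp add: pos_less_divide_eq mult.commute)
      finally have "ennreal (2 * real K * w n) \<le> ennreal e" by (rule ennreal_leI)
      with bound[OF n(1)] show ?thesis by (rule order_trans)
    qed
    then have "emeasure lebesgue (Z m K) \<le> 0 + ennreal e" if "e > 0" for e
      using that by simp
    then have "emeasure lebesgue (Z m K) \<le> 0" by (rule ennreal_le_epsilon)
    then show ?thesis using Z_sets by (auto simp: null_sets_def)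
  qed
  then have "(\<Union>K. Z m K) \<in> null_sets lebesgue" for m by (rule null_sets_UN)
  then have Z_null: "(\<Union>m. \<Union>K. Z m K) \<in> null_sets lebesgue" by (rule null_sets_UN)
  have "X - Core \<subseteq> (\<Union>m. \<Union>K. Z m K)"
  proof
    fix x assume x: "x \<in> X - Core"
    then obtain m j where m: "x \<in> L m j" "j < h m" by (auto simp: X_iff)
    obtain K where K: "\<And>n p. K \<le> p \<Longrightarrow> p + K < h n \<Longrightarrow> x \<notin> L n p"
      using x unfolding Core_def by blast
    have "x \<in> Z m K" unfolding Z_def
    proof (intro INT_I)
      fix n assume "n \<in> {m..}"
      then have "m \<le> n" by simp
      then obtain p where p: "p < h n" "x \<in> L n p" using m by (rule level_refine)
      have "p < K \<or> h n \<le> p + K" using K[of p n] p(2) by linarith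
      with p show "x \<in> (\<Union>p\<in>{p. p < h n \<and> (p < K \<or> h n \<le> p + K)}. L n p)" by blast
    qed
    then show "x \<in> (\<Union>m. \<Union>K. Z m K)" by blast
  qed
  moreover have "X - Core \<in> sets lebesgue" using X_sets Core_sets by auto
  ultimately show ?thesis using null_sets_subset[OF Z_null] by simp
qed

text \<open>
  The exceptional points are the countably many shifts of a null set. This turns statements that
  hold almost everywhere into statements about all points of an invariant set.
\<close>

lemma shift_invariant_conull_subset:
  assumes "N \<in> null_sets lebesgue"
  obtains G where "G \<subseteq> Core - N" "X - G \<in> null_sets lebesgue" "G \<in> sets lebesgue"
    "\<And>k x. x \<in> G \<Longrightarrow> shift k x \<in> G"
proof -
  define G where "G = {x \<in> Core. \<forall>k. shift k x \<notin> N}"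
  have NC: "N \<inter> Core \<in> null_sets lebesgue" using assms Core_sets by (rule null_set_Int2)
  have "Core - G = (\<Union>k. shift k ` (N \<inter> Core))"
  proof (rule set_eqI)
    fix x
    show "x \<in> Core - G \<longleftrightarrow> x \<in> (\<Union>k. shift k ` (N \<inter> Core))"
    proof
      assume "x \<in> Core - G"
      then obtain k where k: "shift k x \<in> N" "x \<in> Core" unfolding G_def by auto
      then have "x \<in> shift (-k) ` (N \<inter> Core)"
        using shift_inverse(1)[of x k] shift_in_Core[of x k] by (metis IntI image_eqI)
      then show "x \<in> (\<Union>k. shift k ` (N \<inter> Core))" by blast
    next
      assume "x \<in> (\<Union>k. shift k ` (N \<inter> Core))"
      then obtain k y where y: "y \<in> N" "y \<in> Core" "x = shift k y" by auto
      then have "x \<in> Core" "shift (-k) x \<in> N" by (auto simp: shift_in_Core shift_inverse)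
      then show "x \<in> Core - G" unfolding G_def by auto
    qed
  qed
  moreover have "(\<Union>k. shift k ` (N \<inter> Core)) \<in> null_sets lebesgue"
    using shift_null[OF NC] by (intro null_sets_UN') auto
  ultimately have CG: "Core - G \<in> null_sets lebesgue" by simp
  have GC: "G \<subseteq> Core" unfolding G_def by auto
  have "X - G = (X - Core) \<union> (Core - G)" using GC Core_subset_X by auto
  then have XG: "X - G \<in> null_sets lebesgue" using CG X_minus_Core_null by auto
  have "G = Core - (Core - G)" using GC by auto
  then have "G \<in> sets lebesgue" using CG Core_sets by (metis null_setsD2 sets.Diff)
  moreover have "G \<subseteq> Core - N" unfolding G_def by (auto dest: spec[of _ 0] simp: shift_0)
  moreover have "shift k x \<in> G" if "x \<in> G" for k x
    using that unfolding G_def by (auto simp: shift_shift shift_in_Core)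
  ultimately show ?thesis using that XG by blast
qed

section \<open>Ergodicity of the shifts\<close>

lemma level_measure_invariant:
  assumes A: "A \<in> sets lebesgue" "A \<subseteq> Core" "\<And>k x. x \<in> A \<Longrightarrow> shift k x \<in> A" and p: "p < h n"
  shows "emeasure lebesgue (A \<inter> L n p) = emeasure lebesgue (A \<inter> L n 0)"
proof -
  have "shift (int p) ` (A \<inter> L n 0) = A \<inter> L n p"
  proof (rule set_eqI)
    fix z
    show "z \<in> shift (int p) ` (A \<inter> L n 0) \<longleftrightarrow> z \<in> A \<inter> L n p"
    proof
      assume "z \<in> shift (int p) ` (A \<inter> L n 0)"
      then show "z \<in> A \<inter> L n p" using A(3) shift_level[of _ n 0 p] p h_pos[of n] by auto
    next
      assume z: "z \<in> A \<inter> L n p"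
      then have "shift (- int p) z \<in> A \<inter> L n 0"
        using A(3) shift_level[of z n p 0 "- int p"] p h_pos[of n] by auto
      then have "shift (int p) (shift (- int p) z) \<in> shift (int p) ` (A \<inter> L n 0)" by (rule imageI)
      then show "z \<in> shift (int p) ` (A \<inter> L n 0)"
        using z A(2) by (simp add: shift_inverse subset_iff)
    qed
  qed
  moreover have "emeasure lebesgue (shift (int p) ` (A \<inter> L n 0)) = emeasure lebesgue (A \<inter> L n 0)"
    using A level_sets by (intro shift_preserves_measure) auto
  ultimately show ?thesis by simp
qed

lemma grid_width: "real (\<Prod>i<n. r i) * w n = 1"
proof (induction n)
  case (Suc n)
  have "real (\<Prod>i<Suc n. r i) * w (Suc n) = real (\<Prod>i<n. r i) * (real (r n) * w (Suc n))"
    by (simp del: level_width.simps)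
  then show ?case using Suc by (simp only: w_Suc)
qed simp

text \<open>
  The levels of \<open>C\<^sub>n\<close> inside the unit interval are the cells of a regular grid, because cutting a
  level divides it into equal parts. The order of these cells in the column does not follow the
  line, but for an invariant set all cells count equally.
\<close>

lemma grid_level:
  assumes "j < (\<Prod>i<n. r i)"
  obtains p where "p < h n" "L n p = {real j * w n ..< real (Suc j) * w n}"
proof -
  have "\<exists>p<h n. a n p = real j * w n" using assms
  proof (induction n arbitrary: j)
    case 0
    moreover have "a 0 0 = 0" using stacking unfolding cutting_and_stacking_def by blast
    ultimately show ?case by simp
  next
    case (Suc n)
    have rn: "0 < r n" by (rule r_pos)
    have "j div r n < (\<Prod>i<n. r i)"
      using Suc.prems rn by (simp add: div_less_iff_less_mult)
    then obtain p where p: "p < h n" "a n p = real (j div r n) * w n" using Suc.IH by blast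
    \<comment> \<open>Cell \<open>j\<close> is the piece number \<open>j mod r n\<close> of the cell \<open>j div r n\<close> of the coarser grid.\<close>
    define i where "i = j mod r n"
    have i: "i < r n" unfolding i_def using rn by simp
    have "a (Suc n) (start n i + p) = real (j div r n * r n + i) * w (Suc n)"
      unfolding endpoint_Suc[OF i p(1)] p(2) w_Suc[of n, symmetric]
      by (simp add: algebra_simps del: level_width.simps)
    also have "j div r n * r n + i = j" unfolding i_def by simp
    finally show ?case using start_add_less[OF i p(1)] by (intro exI[of _ "start n i + p"] conjI)
  qed
  then obtain p where p: "p < h n" "a n p = real j * w n" by blast
  show ?thesis by (rule that[OF p(1)]) (simp add: level_def p(2) algebra_simps)
qed

lemma invariant_grid_measure:
  assumes A: "A \<in> sets lebesgue" "A \<subseteq> Core" "\<And>k x. x \<in> A \<Longrightarrow> shift k x \<in> A"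
    and j: "j \<le> (\<Prod>i<n. r i)"
  shows "measure lebesgue (A \<inter> {0..<real j * w n}) = measure lebesgue (A \<inter> {0..<1}) * (real j * w n)"
proof -
  define c where "c = measure lebesgue (A \<inter> L n 0)"
  have fin: "A \<inter> {x..<y} \<in> lmeasurable" for x y
    using A(1) by (rule Int_interval_lmeasurable)
  have *: "measure lebesgue (A \<inter> {0..<real j * w n}) = real j * c" if "j \<le> (\<Prod>i<n. r i)" for j
    using that
  proof (induction j)
    case (Suc j)
    then obtain p where p: "p < h n" "L n p = {real j * w n ..< real (Suc j) * w n}"
      using grid_level[of j n] by auto
    have "0 \<le> real j * w n" "real j * w n \<le> real (Suc j) * w n"
      using w_pos[of n] by (auto intro: mult_right_mono)
    then have "{0..<real (Suc j) * w n} = {0..<real j * w n} \<union> {real j * w n ..< real (Suc j) * w n}"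
      by (rule ivl_disj_un_two(3)[symmetric])
    then have "A \<inter> {0..<real (Suc j) * w n} = (A \<inter> {0..<real j * w n}) \<union> (A \<inter> L n p)"
      unfolding p(2) by blast
    moreover have "(A \<inter> {0..<real j * w n}) \<inter> (A \<inter> L n p) = {}" unfolding p(2) by auto
    moreover have "A \<inter> L n p \<in> lmeasurable" unfolding p(2) by (rule fin)
    ultimately have "measure lebesgue (A \<inter> {0..<real (Suc j) * w n})
        = measure lebesgue (A \<inter> {0..<real j * w n}) + measure lebesgue (A \<inter> L n p)"
      using fin by (simp add: measure_Un3)
    also have "measure lebesgue (A \<inter> L n p) = c"
      unfolding c_def measure_def using level_measure_invariant[OF A p(1)] by simp
    finally show ?case using Suc by (simp add: algebra_simps)
  qed simp
  have "measure lebesgue (A \<inter> {0..<1}) = real (\<Prod>i<n. r i) * c"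
    using *[of "\<Prod>i<n. r i"] by (simp only: grid_width order_refl)
  then have "measure lebesgue (A \<inter> {0..<1}) * w n = (real (\<Prod>i<n. r i) * w n) * c"
    by (simp only: mult.commute mult.left_commute)
  then have "c = measure lebesgue (A \<inter> {0..<1}) * w n" by (simp only: grid_width)
  then show ?thesis using *[OF j] by simp
qed

text \<open>
  The two sides agree when \<open>t\<close> is a grid point, both are monotone in \<open>t\<close>, and the grids become
  arbitrarily fine.
\<close>

lemma invariant_interval_measure:
  assumes A: "A \<in> sets lebesgue" "A \<subseteq> Core" "\<And>k x. x \<in> A \<Longrightarrow> shift k x \<in> A"
    and t: "0 \<le> t" "t \<le> 1"
  shows "measure lebesgue (A \<inter> {0..<t}) = measure lebesgue (A \<inter> {0..<1}) * t"
proof (cases "t = 1")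
  case False
  define c where "c = measure lebesgue (A \<inter> {0..<1})"
  define m where "m u = measure lebesgue (A \<inter> {0..<u})" for u :: real
  have fin: "A \<inter> {x..<y} \<in> lmeasurable" for x y
    using A(1) by (rule Int_interval_lmeasurable)
  have mono: "m u \<le> m v" if "u \<le> v" for u v
    unfolding m_def using that fin by (intro measure_mono_fmeasurable) auto
  have c0: "0 \<le> c" "c \<le> 1"
  proof -
    have "c \<le> measure lebesgue {0..<1::real}"
      unfolding c_def using fin by (intro measure_mono_fmeasurable) (auto intro: interval_lmeasurable)
    then show "c \<le> 1" by simp
  qed (simp add: c_def)
  have "\<bar>m t - c * t\<bar> \<le> w n" for n
  proof -
    define j where "j = nat \<lfloor>t / w n\<rfloor>"
    have "0 \<le> t / w n" using t w_pos[of n] by simp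
    then have j: "real j \<le> t / w n" "t / w n < real j + 1" unfolding j_def by linarith+
    then have j': "real j * w n \<le> t" "t < real (Suc j) * w n"
      using w_pos[of n] by (auto simp: pos_le_divide_eq pos_divide_less_eq algebra_simps)
    have "real j * w n < real (\<Prod>i<n. r i) * w n" using j' t False grid_width[of n] by linarith
    then have "j < (\<Prod>i<n. r i)" using w_pos[of n] by (simp only: mult_less_cancel_right_pos of_nat_less_iff)
    then have "m (real j * w n) = c * (real j * w n)" "m (real (Suc j) * w n) = c * (real (Suc j) * w n)"
      unfolding m_def c_def by (intro invariant_grid_measure[OF A]; simp)+
    moreover have "m (real j * w n) \<le> m t" "m t \<le> m (real (Suc j) * w n)"
      using j' by (auto intro!: mono)
    moreover have "c * (real j * w n) \<le> c * t" "c * t \<le> c * (real (Suc j) * w n)"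
      using j' c0 by (auto intro!: mult_left_mono)
    moreover have "c * (real (Suc j) * w n) = c * (real j * w n) + c * w n" by (simp add: algebra_simps)
    moreover have "c * w n \<le> w n" using c0 w_pos[of n] by simp
    ultimately show ?thesis by linarith
  qed
  then have "\<bar>m t - c * t\<bar> = 0"
    using w_small[of "\<bar>m t - c * t\<bar>" 0] by (meson abs_ge_zero not_le order_le_less)
  then show ?thesis unfolding m_def c_def by simp
qed simp

text \<open>
  An invariant set is independent of the half-lines by the previous lemma, hence of all Borel
  sets.
\<close>

lemma invariant_measure_product:
  assumes A: "A \<in> sets lebesgue" "A \<subseteq> Core" "\<And>k x. x \<in> A \<Longrightarrow> shift k x \<in> A"
    and B: "B \<in> sets borel"
  shows "emeasure lebesgue (B \<inter> (A \<inter> {0..<1}))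
       = emeasure lebesgue (A \<inter> {0..<1}) * emeasure lebesgue (B \<inter> {0..<1})"
proof -
  define c where "c = measure lebesgue (A \<inter> {0..<1})"
  have fin: "A \<inter> {x..<y} \<in> lmeasurable" for x y
    using A(1) by (rule Int_interval_lmeasurable)
  have ec: "emeasure lebesgue (A \<inter> {0..<1}) = ennreal c"
    unfolding c_def using fin by (intro emeasure_eq_measure2) 
  define \<nu> where "\<nu> E = distr (lebesgue_on E) borel (\<lambda>x. x)" for E :: "real set"
  have \<nu>: "emeasure (\<nu> E) F = emeasure lebesgue (F \<inter> E)" if "E \<in> sets lebesgue" "F \<in> sets borel" for E F
  proof -
    have "(\<lambda>x. x) \<in> measurable (lebesgue_on E) borel"
      by (intro measurable_restrict_space1 measurable_completion) simp
    then have "emeasure (\<nu> E) F = emeasure (lebesgue_on E) (F \<inter> E)"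
      unfolding \<nu>_def using that by (subst emeasure_distr) auto
    also have "\<dots> = emeasure lebesgue (F \<inter> E)"
      using that by (intro emeasure_restrict_space) auto
    finally show ?thesis .
  qed
  have A01: "A \<inter> {0..<1} \<in> sets lebesgue" using A by auto
  have "\<nu> (A \<inter> {0..<1}) = scale_measure (ennreal c) (\<nu> {0..<1})"
  proof (rule measure_eqI_lessThan)
    fix x :: real
    show "emeasure (\<nu> (A \<inter> {0..<1})) {x<..} < \<infinity>"
    proof -
      have "emeasure lebesgue ({x<..} \<inter> (A \<inter> {0..<1})) \<le> emeasure lebesgue (A \<inter> {0..<1})"
        using A01 by (intro emeasure_mono) auto
      also have "\<dots> < \<infinity>" by (simp add: ec)
      finally show ?thesis using A01 by (simp add: \<nu>)
    qed
    \<comment> \<open>Clipping \<open>x\<close> to the unit interval changes neither side.\<close>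
    define t where "t = min 1 (max 0 x)"
    have t: "0 \<le> t" "t \<le> 1" unfolding t_def by auto
    have "emeasure lebesgue ({x<..} \<inter> (A \<inter> {0..<1})) = emeasure lebesgue (A \<inter> {t..<1})"
    proof (rule emeasure_eq_AE)
      have "AE y in lebesgue. y \<noteq> t"
        by (rule AE_completion) (rule AE_lborel_singleton)
      then show "AE y in lebesgue. y \<in> {x<..} \<inter> (A \<inter> {0..<1}) \<longleftrightarrow> y \<in> A \<inter> {t..<1}"
        by eventually_elim (auto simp: t_def min_def max_def split: if_splits)
    qed (use A(1) A01 in \<open>auto intro!: sets.Int\<close>)
    also have "\<dots> = ennreal (measure lebesgue (A \<inter> {t..<1}))"
      using fin by (intro emeasure_eq_measure2)
    also have "A \<inter> {t..<1} = A \<inter> {0..<1} - A \<inter> {0..<t}" using t by auto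
    also have "measure lebesgue (A \<inter> {0..<1} - A \<inter> {0..<t}) = c - measure lebesgue (A \<inter> {0..<t})"
      unfolding c_def using fin t by (intro measurable_measure_Diff) auto
    also have "\<dots> = c * (1 - t)"
      using invariant_interval_measure[OF A t] by (simp add: c_def algebra_simps)
    also have "ennreal (c * (1 - t)) = ennreal c * emeasure lebesgue {t..<1}"
      using t by (simp add: ennreal_mult'' c_def)
    also have "emeasure lebesgue {t..<1} = emeasure lebesgue ({x<..} \<inter> {0..<1})"
    proof (rule emeasure_eq_AE)
      have "AE y in lebesgue. y \<noteq> t"
        by (rule AE_completion) (rule AE_lborel_singleton)
      then show "AE y in lebesgue. y \<in> {t..<1} \<longleftrightarrow> y \<in> {x<..} \<inter> {0..<1}"
        by eventually_elim (auto simp: t_def min_def max_def split: if_splits)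
    qed auto
    finally show "emeasure (\<nu> (A \<inter> {0..<1})) {x<..} = emeasure (scale_measure (ennreal c) (\<nu> {0..<1})) {x<..}"
      using A01 by (simp add: \<nu>)
  qed (simp_all add: \<nu>_def)
  then have "emeasure (\<nu> (A \<inter> {0..<1})) B = ennreal c * emeasure (\<nu> {0..<1}) B" by simp
  then show ?thesis using A01 B by (simp add: \<nu> ec)
qed

text \<open>
  Up to a null set, the trace of \<open>A\<close> on the unit interval is a Borel set, so it is independent of
  itself and its measure is a solution of \<open>c = c * c\<close>. Every level of every column is a shift of a
  level inside the unit interval, which carries full measure from there to the whole space.
\<close>

lemma shift_ergodic:
  assumes A: "A \<in> sets lebesgue" "A \<subseteq> Core" "\<And>k x. x \<in> A \<Longrightarrow> shift k x \<in> A"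
    and pos: "A \<inter> {0..<1} \<notin> null_sets lebesgue"
  shows "X - A \<in> null_sets lebesgue"
proof -
  let ?E = "A \<inter> {0..<1}"
  have fin: "?E \<in> lmeasurable"
    using A(1) by (rule Int_interval_lmeasurable)
  have E: "?E \<in> sets lebesgue" using A(1) by auto
  then obtain B N N' where B: "?E = B \<union> N" "N \<subseteq> N'" "N' \<in> null_sets lborel" "B \<in> sets lborel"
    by (rule sets_completionE)
  have N0: "N \<in> null_sets lebesgue"
    using B(2) null_sets_completionI[OF B(3)] by (rule completion.complete2)
  have "emeasure lebesgue ?E = emeasure lebesgue B"
    unfolding B(1) using B(4) N0 by (intro emeasure_Un_null_set) auto
  moreover have "B \<inter> ?E = B" "B \<inter> {0..<1} = B" using B(1) by blast+
  moreover have "B \<in> sets borel" using B(4) by simp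
  ultimately have sq: "emeasure lebesgue ?E = emeasure lebesgue ?E * emeasure lebesgue ?E"
    using invariant_measure_product[OF A, of B] by metis
  define c where "c = measure lebesgue ?E"
  have ec: "emeasure lebesgue ?E = ennreal c"
    unfolding c_def using fin by (rule emeasure_eq_measure2)
  have "0 \<le> c" unfolding c_def by simp
  have "ennreal c = ennreal (c * c)" using sq \<open>0 \<le> c\<close> unfolding ec by (simp add: ennreal_mult)
  then have "c = c * c" using \<open>0 \<le> c\<close> by (simp add: ennreal_inj)
  moreover have "c \<noteq> 0" using pos E ec by (auto simp: null_sets_def)
  ultimately have "measure lebesgue ?E = 1" unfolding c_def[symmetric] by simp
  then have "measure lebesgue ({0..<1} - ?E) = 0"
    using fin by (subst measurable_measure_Diff) (auto intro: interval_lmeasurable)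
  moreover have "{0..<1} - ?E \<in> lmeasurable"
    using fin by (intro fmeasurable_Diff) (auto intro: interval_lmeasurable)
  ultimately have base: "{0..<1} - ?E \<in> null_sets lebesgue"
    by (simp add: emeasure_eq_measure2 null_sets_def fmeasurableD)
  have "X - A \<subseteq> (X - Core) \<union> (\<Union>k. shift k ` (({0..<1} - ?E) \<inter> Core))"
  proof
    fix x assume x: "x \<in> X - A"
    show "x \<in> (X - Core) \<union> (\<Union>k. shift k ` (({0..<1} - ?E) \<inter> Core))"
    proof (cases "x \<in> Core")
      case True
      then obtain n p where p: "p < h n" "x \<in> L n p" using Core_subset_X X_iff by blast
      have "0 < (\<Prod>i<n. r i)" using r_pos by (simp add: prod_pos)
      then obtain q where q: "q < h n" "L n q = {real 0 * w n ..< real (Suc 0) * w n}"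
        using grid_level[of 0 n] by blast
      have "w n \<le> 1" using w_le_power[of n] power_le_one[of "1/2::real" n] by simp
      then have sub: "L n q \<subseteq> {0..<1}" unfolding q(2) by auto
      define k where "k = int q - int p"
      have "shift k x \<in> {0..<1}" using shift_level[OF p(2,1) q(1)] sub k_def by blast
      moreover have "shift (-k) (shift k x) \<notin> A" using x True by (simp add: shift_inverse)
      then have "shift k x \<notin> A" using A(3) by blast
      moreover have "shift k x \<in> Core" using True by (rule shift_in_Core)
      ultimately have "shift k x \<in> ({0..<1} - ?E) \<inter> Core" by blast
      then have "shift (-k) (shift k x) \<in> shift (-k) ` (({0..<1} - ?E) \<inter> Core)" by (rule imageI)
      then have "x \<in> shift (-k) ` (({0..<1} - ?E) \<inter> Core)" using True by (simp add: shift_inverse)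
      then show ?thesis by blast
    qed (use x in auto)
  qed
  moreover have "(X - Core) \<union> (\<Union>k. shift k ` (({0..<1} - ?E) \<inter> Core)) \<in> null_sets lebesgue"
  proof (rule null_sets.Un[OF X_minus_Core_null])
    show "(\<Union>k. shift k ` (({0..<1} - ?E) \<inter> Core)) \<in> null_sets lebesgue"
      using shift_null[OF null_set_Int2[OF base Core_sets]] by (intro null_sets_UN') auto
  qed
  moreover have "X - A \<in> sets lebesgue" using X_sets A(1) by (rule sets.Diff)
  ultimately show ?thesis by (rule null_sets_subset[rotated, rotated])
qed

end

section \<open>Columns with long and nearly equal spacers\<close>

lemma length_rank_one_word:
  assumes "\<And>n. 0 < r n" "\<And>n. s n (r n - 1) = 0"
  shows "length (rank_one_word r s n) = col_height r s n"
proof (induction n)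
  case (Suc n)
  obtain k where k: "r n = Suc k" using assms(1)[of n] by (cases "r n") auto
  have "length (rank_one_word r s (Suc n)) = (\<Sum>i<k. col_height r s n + s n i) + col_height r s n"
    by (simp add: length_concat k Suc comp_def interv_sum_list_conv_sum_set_nat atLeast0LessThan)
  also have "\<dots> = col_height r s (Suc n)"
    using assms(2)[of n] by (simp add: k sum.distrib)
  finally show ?case .
qed simp

locale long_spacer_columns = stacked_columns +
  fixes R N0 :: nat and S :: int
  assumes last_spacer: "\<And>n. s n (r n - 1) = 0"
    and r_less: "\<And>n. N0 \<le> n \<Longrightarrow> r n < R"
    and spacers_close: "\<And>n i j. N0 \<le> n \<Longrightarrow> i < r n - 1 \<Longrightarrow> j < r n - 1 \<Longrightarrow> \<bar>int (s n i) - int (s n j)\<bar> < S"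
    and spacers_long: "\<And>n i. N0 \<le> n \<Longrightarrow> i < r n - 1 \<Longrightarrow> h n \<le> s n i"
    and S_pos: "0 < S"
begin

definition M :: int where "M = int R * S"

text \<open>From \<open>N1\<close> on the columns are so high that the error \<open>M\<close> is at most half their height.\<close>

definition N1 :: nat where "N1 = max N0 (nat (2 * M))"

lemma N0_le_N1: "N0 \<le> N1"
  unfolding N1_def by simp

lemma M_nonneg: "0 \<le> M"
  unfolding M_def using S_pos by simp

lemma h_ge_M: "N1 \<le> n \<Longrightarrow> 2 * M \<le> int (h n)"
  using h_gt[of n] unfolding N1_def by linarith

lemma h_Suc: "h (Suc n) = start n (r n - 1) + h n"
  using start_Suc[of n "r n - 1"] start_r[of n] r_pos[of n] last_spacer[of n] by simp

lemma h_Suc_ge_spacer: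
  assumes "N0 \<le> n" "i < r n - 1"
  shows "2 * h n + s n i \<le> h (Suc n)"
proof -
  have "start n (Suc i) \<le> start n (r n - 1)" using assms by (intro start_mono) auto
  then show ?thesis by (simp add: h_Suc start_Suc del: col_height.simps)
qed

lemma start_gap:
  assumes "N0 \<le> n" "i < j" "j < r n"
  shows "start n i + 2 * h n \<le> start n j"
proof -
  have "start n (Suc i) \<le> start n j" using assms by (intro start_mono) auto
  moreover have "h n \<le> s n i" using assms by (intro spacers_long) auto
  ultimately show ?thesis by (simp add: start_Suc)
qed

text \<open>
  Two stacks of \<open>u\<close> subcolumns with their spacers have nearly the same height: \<open>u < R\<close> spacers are
  compared in pairs, each pair differing by less than \<open>S\<close>.
\<close>

lemma start_windows_close:
  assumes n: "N0 \<le> n" and "i + u < r n" "l + u < r n"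
  shows "\<bar>(int (start n (i + u)) - int (start n i)) - (int (start n (l + u)) - int (start n l))\<bar> \<le> M"
proof -
  have "\<bar>(int (start n (i + u)) - int (start n i)) - (int (start n (l + u)) - int (start n l))\<bar> \<le> int u * S"
    using assms(2,3)
  proof (induction u)
    case (Suc u)
    have "\<bar>int (s n (i + u)) - int (s n (l + u))\<bar> < S"
      using Suc.prems by (intro spacers_close n) auto
    moreover have "\<bar>(int (start n (i + u)) - int (start n i)) - (int (start n (l + u)) - int (start n l))\<bar> \<le> int u * S"
      using Suc by auto
    ultimately show ?case by (auto simp: start_Suc algebra_simps)
  qed simp
  also have "\<dots> \<le> M"
    unfolding M_def using r_less[OF n] assms S_pos by (intro mult_right_mono) auto
  finally show ?thesis .
qed

text \<open>
  Two points of \<open>C\<^sub>m\<close> are either in the same copy of \<open>C\<^sub>m\<close> inside \<open>C\<^sub>n\<close>, or in two copies whose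
  starts are at least \<open>2 * h m\<close> apart, because the spacers between copies are at least as long as
  the column below them, be it \<open>C\<^sub>m\<close> or a later one.
\<close>

lemma visits_far_apart:
  assumes m: "N0 \<le> m" "m \<le> n"
    and x: "x \<in> L m p" "p < h m" and y: "y \<in> L m p'" "p' < h m"
    and x_n: "x \<in> L n P" "P < h n" and y_n: "y \<in> L n P'" "P' < h n"
  shows "int P' - int P = int p' - int p \<or>
         2 * int (h m) \<le> \<bar>(int P' - int P) - (int p' - int p)\<bar>"
  using m(2) x_n y_n
proof (induction n arbitrary: P P' rule: dec_induct)
  case base
  then have "P = p" "P' = p'" using x y level_unique by blast+
  then show ?case by simp
next
  case (step n)
  obtain Q where Q: "Q < h n" "x \<in> L n Q" "p \<le> Q" "Q - p + h m \<le> h n"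
    by (rule level_refine[OF step(1) x]) auto
  obtain Q' where Q': "Q' < h n" "y \<in> L n Q'" "p' \<le> Q'" "Q' - p' + h m \<le> h n"
    by (rule level_refine[OF step(1) y]) auto
  obtain i where i: "i < r n" "x \<in> L (Suc n) (start n i + Q)" by (rule sublevel_exists[OF Q(2,1)])
  obtain i' where i': "i' < r n" "y \<in> L (Suc n) (start n i' + Q')" by (rule sublevel_exists[OF Q'(2,1)])
  have P: "P = start n i + Q" "P' = start n i' + Q'"
    using level_unique step.prems i i' start_add_less Q(1) Q'(1) by blast+
  have IH: "int Q' - int Q = int p' - int p \<or> 2 * int (h m) \<le> \<bar>(int Q' - int Q) - (int p' - int p)\<bar>"
    by (rule step.IH) (use Q Q' in auto)
  have hm: "h m \<le> h n" using step(1) by (rule h_mono)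
  have N: "N0 \<le> n" using m step by auto
  consider "i = i'" | "i < i'" | "i' < i" by linarith
  then show ?case
  proof cases
    case 1
    then show ?thesis using IH P by simp
  next
    case 2
    then show ?thesis using start_gap[OF N 2 i'(1)] Q Q' hm unfolding P by linarith
  next
    case 3
    then show ?thesis using start_gap[OF N 3 i(1)] Q Q' hm unfolding P by linarith
  qed
qed

lemma return_times:
  assumes "N0 \<le> m" "x \<in> Core" "x \<in> L m p" "p < h m" "shift k x \<in> L m p'" "p' < h m"
  shows "k = int p' - int p \<or> 2 * int (h m) \<le> \<bar>k - (int p' - int p)\<bar>"
proof -
  obtain n P P' where n: "m \<le> n" "P + 0 < h n" "P' + 0 < h n" "x \<in> L n P" "int P' - int P = k" "moves n P P' x (shift k x)"
    using assms(2) by (rule Core_shift[where N=m and K=0 and k=k])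
  then show ?thesis using visits_far_apart[OF assms(1) n(1) assms(3-6), of P P'] moves_levels[OF n(6)] by auto
qed

text \<open>
  Consecutive half-open intervals: this is what separates the exit regions of different columns.
  The offset \<open>M\<close> absorbs the differences between spacers.
\<close>

definition exit_times :: "nat \<Rightarrow> int set" where
  "exit_times n = {int (h n) - M <.. int (h (Suc n)) - M}"

text \<open>
  The level through which a point leaves the column: the top one in the direction \<open>\<sigma> = 1\<close>, the
  bottom one in the direction \<open>\<sigma> = -1\<close>.
\<close>

definition rim :: "int \<Rightarrow> nat \<Rightarrow> nat" where
  "rim \<sigma> n = (if \<sigma> = 1 then h n - 1 else 0)"

text \<open>
  The points that, moving in the direction \<open>\<sigma>\<close>, were at the rim of \<open>C\<^sub>n\<^sub>+\<^sub>1\<close> a number of steps ago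
  that is in \<open>exit_times n\<close>.
\<close>

definition exit_region :: "int \<Rightarrow> nat \<Rightarrow> real set" where
  "exit_region \<sigma> n = {z \<in> Core. \<exists>t\<in>exit_times n. shift (- (\<sigma> * t)) z \<in> L (Suc n) (rim \<sigma> (Suc n))}"

lemma rim_less: "rim \<sigma> n < h n"
  unfolding rim_def using h_pos[of n] by auto

lemma exit_region_sets: "exit_region \<sigma> n \<in> sets lebesgue"
proof -
  have "exit_region \<sigma> n = (\<Union>t\<in>exit_times n. shift (\<sigma> * t) ` (L (Suc n) (rim \<sigma> (Suc n)) \<inter> Core))"
    (is "_ = (\<Union>t\<in>_. ?E t)")
  proof (rule set_eqI)
    fix z
    have "z \<in> ?E t \<longleftrightarrow> z \<in> Core \<and> shift (- (\<sigma> * t)) z \<in> L (Suc n) (rim \<sigma> (Suc n))" for t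
      using shift_image_iff[of "L (Suc n) (rim \<sigma> (Suc n)) \<inter> Core" z "\<sigma> * t"]
      by (auto simp: shift_in_Core)
    then show "z \<in> exit_region \<sigma> n \<longleftrightarrow> z \<in> (\<Union>t\<in>exit_times n. ?E t)"
      unfolding exit_region_def by blast
  qed
  moreover have "?E t \<in> sets lebesgue" for t
    using level_sets Core_sets by (intro shift_preserves_measure) auto
  moreover have "finite (exit_times n)" unfolding exit_times_def by simp
  ultimately show ?thesis by auto
qed

text \<open>
  For \<open>m < n\<close>, a common point would have left \<open>C\<^sub>m\<^sub>+\<^sub>1\<close>, and so have been in \<open>C\<^sub>n\<^sub>+\<^sub>1\<close>, later than
  it left \<open>C\<^sub>n\<^sub>+\<^sub>1\<close>, but at most \<open>h (Suc n)\<close> steps later. It takes more time than this to return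
  from the rim of \<open>C\<^sub>n\<^sub>+\<^sub>1\<close> to that column.
\<close>

lemma exit_regions_disjoint:
  assumes \<sigma>: "\<sigma> = 1 \<or> \<sigma> = -1" and mn: "N1 \<le> m" "m < n"
  shows "exit_region \<sigma> m \<inter> exit_region \<sigma> n = {}"
proof (rule ccontr)
  assume "\<not> ?thesis"
  then obtain z t t' where z: "z \<in> Core"
    and t: "t \<in> exit_times m" "shift (- (\<sigma> * t)) z \<in> L (Suc m) (rim \<sigma> (Suc m))"
    and t': "t' \<in> exit_times n" "shift (- (\<sigma> * t')) z \<in> L (Suc n) (rim \<sigma> (Suc n))"
    unfolding exit_region_def by blast
  \<comment> \<open>The point of the orbit at which it leaves the larger column.\<close>
  let ?x = "shift (- (\<sigma> * t')) z"
  have hm: "h (Suc m) \<le> h n" using mn by (intro h_mono) auto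
  have tt: "0 < t" "t < t'" "t' \<le> int (h (Suc n))"
    using t(1) t'(1) hm h_ge_M[of m] mn M_nonneg h_pos[of m] unfolding exit_times_def greaterThanAtMost_iff
    by linarith+
  have "shift (\<sigma> * (t' - t)) ?x = shift (- (\<sigma> * t)) z"
    using z by (simp add: shift_shift algebra_simps)
  moreover obtain p where p: "p < h (Suc n)" "shift (- (\<sigma> * t)) z \<in> L (Suc n) p"
    by (rule level_refine[OF _ t(2), of "Suc n"]) (use mn rim_less[of \<sigma> "Suc m"] in \<open>auto simp del: col_height.simps\<close>)
  ultimately have "\<sigma> * (t' - t) = int p - int (rim \<sigma> (Suc n)) \<or>
      2 * int (h (Suc n)) \<le> \<bar>\<sigma> * (t' - t) - (int p - int (rim \<sigma> (Suc n)))\<bar>"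
    using z N0_le_N1 mn
    by (intro return_times[where x="?x"]) (use t'(2) rim_less in \<open>auto simp: shift_in_Core simp del: col_height.simps\<close>)
  then show False using \<sigma> tt p(1) unfolding rim_def by (auto simp del: col_height.simps)
qed

text \<open>
  If \<open>x\<close> and its partner are in the subcolumns \<open>i \<noteq> l\<close>, the move of \<open>x\<close> to the subcolumn \<open>displace
  n i l\<close> crosses as many subcolumns as the partner needs to get out of \<open>C\<^sub>n\<^sub>+\<^sub>1\<close>: \<open>r n - l\<close>
  upwards, or \<open>l + 1\<close> downwards. There is room for it since \<open>x\<close> is on the far side of its partner.
\<close>

definition displace :: "nat \<Rightarrow> nat \<Rightarrow> nat \<Rightarrow> nat" where
  "displace n i l = (if i < l then i + (r n - l) else i - l - 1)"

definition side :: "nat \<Rightarrow> nat \<Rightarrow> int" where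
  "side i l = (if i < l then 1 else -1)"

lemma displace_less: "i < r n \<Longrightarrow> l < r n \<Longrightarrow> displace n i l < r n"
  unfolding displace_def by auto

text \<open>
  Here \<open>y\<close> is the partner. The move crosses one spacer more than there is between \<open>y\<close> and the rim,
  while the other spacers cancel up to \<open>M\<close>. The time \<open>t\<close> spent outside is thus one spacer, up to
  \<open>M\<close> and up to a part of the height \<open>h n\<close>. A spacer is at least \<open>h n\<close> and at most \<open>h (Suc n) - 2
  * h n\<close>, and \<open>2 * M \<le> h n\<close>, so \<open>t\<close> is an exit time.
\<close>

lemma displaced_exits:
  assumes n: "N1 \<le> n" and i: "i < r n" and l: "l < r n" "i \<noteq> l"
    and y: "y \<in> Core" "y \<in> L (Suc n) (start n l + q)" "q < h n"
  shows "shift (int (start n (displace n i l)) - int (start n i)) y \<in> exit_region (side i l) n"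
proof -
  have N: "N0 \<le> n" using n N0_le_N1 by simp
  define k where "k = int (start n (displace n i l)) - int (start n i)"
  have q: "start n l + q < h (Suc n)" using l y by (intro start_add_less)
  consider "i < l" | "l < i" using l by linarith
  then show ?thesis
  proof cases
    case 1
    define u where "u = r n - 1 - l"
    have u: "i + u < r n - 1" "l + u = r n - 1" "displace n i l = Suc (i + u)"
      using 1 l unfolding u_def displace_def by auto
    \<comment> \<open>The steps that remain of \<open>k\<close> after \<open>y\<close> has reached the top level.\<close>
    define t where "t = k - (int (h (Suc n)) - 1 - int (start n l + q))"
    have win: "\<bar>(int (start n (i + u)) - int (start n i)) - (int (start n (l + u)) - int (start n l))\<bar> \<le> M"
      using u l by (intro start_windows_close N) auto
    \<comment> \<open>The move crosses \<open>u + 1\<close> subcolumns, but only \<open>u\<close> separate \<open>y\<close> from the last one.\<close>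
    have t_eq: "t = (int (start n (i + u)) - int (start n i)) - (int (start n (l + u)) - int (start n l))
        + int (s n (i + u)) + 1 + int q"
      unfolding t_def k_def u(3) start_Suc h_Suc u(2) by simp
    have "t \<in> exit_times n"
      using win spacers_long[OF N u(1)] h_Suc_ge_spacer[OF N u(1)] h_ge_M[OF n] y(3)
      unfolding exit_times_def t_eq greaterThanAtMost_iff by linarith
    moreover have "shift (- (side i l * t)) (shift k y) = shift (int (h (Suc n)) - 1 - int (start n l + q)) y"
      using 1 y(1) by (simp add: side_def shift_shift t_def algebra_simps del: col_height.simps)
    moreover have "shift (int (h (Suc n)) - 1 - int (start n l + q)) y \<in> L (Suc n) (rim (side i l) (Suc n))"
      using 1 q by (intro shift_level[OF y(2) q rim_less]) (simp add: rim_def side_def del: col_height.simps)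
    ultimately have "\<exists>t\<in>exit_times n. shift (- (side i l * t)) (shift k y) \<in> L (Suc n) (rim (side i l) (Suc n))"
      by (intro bexI[of _ t]) (simp_all only:)
    then show ?thesis using shift_in_Core[OF y(1)] unfolding exit_region_def k_def by simp
  next
    case 2
    define j where "j = i - l - 1"
    have j: "j + l = i - 1" "displace n i l = j" "i = Suc (j + l)"
      using 2 unfolding j_def displace_def by auto
    \<comment> \<open>The downward steps that remain after \<open>y\<close> has reached the bottom level.\<close>
    define t where "t = - k - int (start n l + q)"
    have win: "\<bar>(int (start n (j + l)) - int (start n j)) - (int (start n (0 + l)) - int (start n 0))\<bar> \<le> M"
      using j i l by (intro start_windows_close N) auto
    have jl: "j + l < r n - 1" using j i by simp
    have t_eq: "t = (int (start n (j + l)) - int (start n j)) - (int (start n (0 + l)) - int (start n 0))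
        + int (s n (j + l)) + int (h n) - int q"
      unfolding t_def k_def j(2) unfolding j(3) start_Suc by simp
    have "t \<in> exit_times n"
      using win spacers_long[OF N jl] h_Suc_ge_spacer[OF N jl] h_ge_M[OF n] y(3)
      unfolding exit_times_def t_eq greaterThanAtMost_iff by linarith
    moreover have "shift (- (side i l * t)) (shift k y) = shift (- int (start n l + q)) y"
      using 2 y(1) by (simp add: side_def shift_shift t_def)
    moreover have "shift (- int (start n l + q)) y \<in> L (Suc n) (rim (side i l) (Suc n))"
      using 2 q by (intro shift_level[OF y(2) q rim_less]) (simp add: rim_def side_def)
    ultimately have "\<exists>t\<in>exit_times n. shift (- (side i l * t)) (shift k y) \<in> L (Suc n) (rim (side i l) (Suc n))"
      by (intro bexI[of _ t]) (simp_all only:)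
    then show ?thesis using shift_in_Core[OF y(1)] unfolding exit_region_def k_def by simp
  qed
qed

end

section \<open>Maps commuting with the shifts\<close>

text \<open>
  \<open>G\<close> is an invariant set of full measure on which the map commutes with every shift without
  exception; \<open>commutes_with_shifts\<close> below provides it.
\<close>

locale commuting_map = long_spacer_columns +
  fixes \<Phi> :: "real \<Rightarrow> real" and G :: "real set"
  assumes \<Phi>_measurable: "\<Phi> \<in> measurable (lebesgue_on X) (lebesgue_on X)"
    and \<Phi>_distr: "distr (lebesgue_on X) (lebesgue_on X) \<Phi> = lebesgue_on X"
    and G_Core: "G \<subseteq> Core" and G_sets: "G \<in> sets lebesgue" and G_conull: "X - G \<in> null_sets lebesgue"
    and G_shift: "\<And>k x. x \<in> G \<Longrightarrow> shift k x \<in> G"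
    and \<Phi>_Core: "\<And>x. x \<in> G \<Longrightarrow> \<Phi> x \<in> Core"
    and \<Phi>_shift: "\<And>k x. x \<in> G \<Longrightarrow> \<Phi> (shift k x) = shift k (\<Phi> x)"
begin

lemmas \<Phi>_vimage = measure_preserving_vimage[OF X_sets \<Phi>_measurable \<Phi>_distr]

definition subcolumn :: "nat \<Rightarrow> nat \<Rightarrow> real set" where
  "subcolumn n i = (\<Union>p<h n. L (Suc n) (start n i + p))"

definition split_points :: "nat \<Rightarrow> nat \<Rightarrow> nat \<Rightarrow> real set" where
  "split_points n i l = {x \<in> G \<inter> {0..<1}. x \<in> subcolumn n i \<and> \<Phi> x \<in> subcolumn n l}"

definition escape :: "int \<Rightarrow> nat \<Rightarrow> real set" where
  "escape \<sigma> n = {0..<1} \<inter> (\<Phi> -` exit_region \<sigma> n \<inter> X)"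

lemma subcolumn_subset_X:
  assumes "l < r n"
  shows "subcolumn n l \<subseteq> X"
proof
  fix x assume "x \<in> subcolumn n l"
  then obtain p where "p < h n" "x \<in> L (Suc n) (start n l + p)" unfolding subcolumn_def by auto
  then show "x \<in> X" using start_add_less[OF assms] X_iff by blast
qed

lemma split_points_sets: 
  assumes "l < r n"
  shows "split_points n i l \<in> sets lebesgue"
proof -
  have "split_points n i l = G \<inter> {0..<1} \<inter> subcolumn n i \<inter> (\<Phi> -` subcolumn n l \<inter> X)"
    using G_Core Core_subset_X unfolding split_points_def by auto
  moreover have sub: "subcolumn n j \<in> sets lebesgue" for j unfolding subcolumn_def using level_sets by auto
  moreover have "\<Phi> -` subcolumn n l \<inter> X \<in> sets lebesgue"
    using sub subcolumn_subset_X[OF assms] by (rule \<Phi>_vimage(1))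
  moreover have "G \<inter> {0..<1} \<in> sets lebesgue" using G_sets by auto
  ultimately show ?thesis by simp
qed

lemma exit_region_subset_X: "exit_region \<sigma> n \<subseteq> X"
  using Core_subset_X unfolding exit_region_def by auto

lemma escape_sets: "escape \<sigma> n \<in> sets lebesgue"
  unfolding escape_def using \<Phi>_vimage(1)[OF exit_region_sets exit_region_subset_X] by auto

text \<open>
  The displacement is a shift, so it preserves measure. It keeps \<open>x\<close> in its level of \<open>C\<^sub>n\<close>, hence
  in the unit interval, and it moves the image of \<open>x\<close> by the same amount into the exit region.
\<close>

lemma split_points_le_escape:
  assumes n: "N1 \<le> n" and i: "i < r n" and l: "l < r n" "i \<noteq> l"
  shows "emeasure lebesgue (split_points n i l) \<le> emeasure lebesgue (escape (side i l) n)"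
proof -
  define k where "k = int (start n (displace n i l)) - int (start n i)"
  have dl: "displace n i l < r n" using i l by (intro displace_less)
  have "shift k ` split_points n i l \<subseteq> escape (side i l) n"
  proof
    fix z assume "z \<in> shift k ` split_points n i l"
    then obtain x p q where x: "x \<in> G" "0 \<le> x" "x < 1" "z = shift k x"
      and p: "p < h n" "x \<in> L (Suc n) (start n i + p)"
      and q: "q < h n" "\<Phi> x \<in> L (Suc n) (start n l + q)"
      unfolding split_points_def subcolumn_def by auto
    have "z \<in> L (Suc n) (start n (displace n i l) + p)"
      unfolding x(4) by (rule shift_level[OF p(2)])
        (use start_add_less[OF i p(1)] start_add_less[OF dl p(1)] in \<open>auto simp: k_def\<close>)
    then have z: "z \<in> L n p" using sublevel[OF dl p(1)] by blast
    have "x \<in> L 0 0" using x by (simp add: level_0)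
    then obtain p' where p': "p' < h n" "x \<in> L n p'" "L n p' \<subseteq> L 0 0"
      by (rule level_refine[rotated]) auto
    have "x \<in> L n p" using sublevel[OF i p(1)] p(2) by blast
    then have "p' = p" using level_unique p p' by blast
    then have "z \<in> {0..<1}" using z p'(3) unfolding level_0 by blast
    moreover have "\<Phi> z = shift k (\<Phi> x)" using \<Phi>_shift x by simp
    then have "\<Phi> z \<in> exit_region (side i l) n"
      using displaced_exits[OF n i l \<Phi>_Core[OF x(1)] q(2,1)] unfolding k_def by simp
    moreover have "z \<in> X" using G_shift x(1,4) G_Core Core_subset_X by blast
    ultimately show "z \<in> escape (side i l) n" unfolding escape_def by blast
  qed
  then have "emeasure lebesgue (shift k ` split_points n i l) \<le> emeasure lebesgue (escape (side i l) n)"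
    using escape_sets by (rule emeasure_mono)
  moreover have "emeasure lebesgue (shift k ` split_points n i l) = emeasure lebesgue (split_points n i l)"
    using split_points_sets[OF l(1)] G_Core
    by (intro shift_preserves_measure) (auto simp: split_points_def)
  ultimately show ?thesis by simp
qed

text \<open>
  The escape sets are disjoint parts of the unit interval and dominate the sets of split points.
\<close>

lemma eventually_not_split:
  assumes il: "i \<noteq> l"
  shows "AE x in lebesgue. eventually (\<lambda>n. i < r n \<longrightarrow> l < r n \<longrightarrow> x \<notin> split_points n i l) sequentially"
proof -
  define A where "A n = (if i < r (n + N1) \<and> l < r (n + N1) then split_points (n + N1) i l else {})" for n
  have "AE x in lebesgue. eventually (\<lambda>n. x \<notin> A n) sequentially"
  proof (rule eventually_avoids_dominated_sets[where B="{0..<1}" and E="\<lambda>n. escape (side i l) (n + N1)"])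
    have side: "side i l = 1 \<or> side i l = -1" unfolding side_def by auto
    have "escape (side i l) (m + N1) \<inter> escape (side i l) (n + N1) = {}" if "m < n" for m n
      using exit_regions_disjoint[OF side, of "m + N1" "n + N1"] that unfolding escape_def by auto
    then show "disjoint_family (\<lambda>n. escape (side i l) (n + N1))"
      unfolding disjoint_family_on_def by (metis (no_types, lifting) Int_commute linorder_neqE_nat)
    show "emeasure lebesgue (A n) \<le> emeasure lebesgue (escape (side i l) (n + N1))" for n
      unfolding A_def using split_points_le_escape[of "n + N1" i l] il by auto
    show "A n \<in> sets lebesgue" for n unfolding A_def using split_points_sets by auto
  qed (auto simp: escape_sets, auto simp: escape_def)
  then show ?thesis
  proof (rule AE_mp, intro AE_I2 impI)
    fix x assume "eventually (\<lambda>n. x \<notin> A n) sequentially"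
    then have "eventually (\<lambda>n. i < r (n + N1) \<longrightarrow> l < r (n + N1) \<longrightarrow> x \<notin> split_points (n + N1) i l) sequentially"
      by (rule eventually_mono) (auto simp: A_def split: if_splits)
    then show "eventually (\<lambda>n. i < r n \<longrightarrow> l < r n \<longrightarrow> x \<notin> split_points n i l) sequentially"
      by (rule iffD1[OF eventually_sequentially_seg])
  qed
qed

text \<open>
  Equal digits add the same amount to both positions, so their difference \<open>d\<close> is constant. Then \<open>\<Phi>
  x\<close> and \<open>shift d x\<close> share a level of every late column, and the widths of these tend to zero.
\<close>

lemma same_subcolumns_imp_shift:
  assumes x: "x \<in> G" "0 \<le> x" "x < 1"
    and N: "\<And>n i l. n \<ge> N \<Longrightarrow> i < r n \<Longrightarrow> l < r n \<Longrightarrow> i \<noteq> l \<Longrightarrow> x \<notin> split_points n i l"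
  shows "\<exists>d. \<Phi> x = shift d x"
proof -
  obtain m q0 where m: "N \<le> m" "q0 + 0 < h m" "\<Phi> x \<in> L m q0"
    using \<Phi>_Core[OF x(1)] by (rule Core_deep[where N=N and K=0])
  have "x \<in> L 0 0" using x by (simp add: level_0)
  then obtain p0 where p0: "p0 < h m" "x \<in> L m p0" by (rule level_refine[rotated]) auto
  define d where "d = int q0 - int p0"
  have track: "\<exists>p q. p < h n \<and> q < h n \<and> x \<in> L n p \<and> \<Phi> x \<in> L n q \<and> int q - int p = d" if "m \<le> n" for n
    using that
  proof (induction rule: dec_induct)
    case base
    show ?case using m(2,3) p0 by (intro exI[of _ p0] exI[of _ q0]) (simp add: d_def)
  next
    case (step n)
    then obtain p q where pq: "p < h n" "q < h n" "x \<in> L n p" "\<Phi> x \<in> L n q" "int q - int p = d" by blast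
    obtain i where i: "i < r n" "x \<in> L (Suc n) (start n i + p)" by (rule sublevel_exists[OF pq(3,1)])
    obtain l where l: "l < r n" "\<Phi> x \<in> L (Suc n) (start n l + q)" by (rule sublevel_exists[OF pq(4,2)])
    have "x \<in> split_points n i l" using x i l pq unfolding split_points_def subcolumn_def by auto
    moreover have "N \<le> n" using step(1) m(1) by simp
    ultimately have il: "i = l" using N[OF _ i(1) l(1)] by blast
    have "int (start n i + q) - int (start n i + p) = d" using pq(5) by simp
    then show ?case
      using i(2) l(2) start_add_less[OF i(1) pq(1)] start_add_less[OF i(1) pq(2)] unfolding il
      by (intro exI[of _ "start n l + p"] exI[of _ "start n l + q"] conjI)
  qed
  have close: "\<bar>\<Phi> x - shift d x\<bar> < w n" if n: "m \<le> n" for n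
  proof -
    obtain p q where pq: "p < h n" "q < h n" "x \<in> L n p" "\<Phi> x \<in> L n q" "int q - int p = d"
      using track[OF n] by blast
    have "shift d x \<in> L n q" using pq(3,1,2,5) by (rule shift_level)
    then show ?thesis using pq(4) unfolding level_def by auto
  qed
  have "\<Phi> x = shift d x"
  proof (rule ccontr)
    assume "\<Phi> x \<noteq> shift d x"
    then obtain n where "m \<le> n" "w n < \<bar>\<Phi> x - shift d x\<bar>"
      using w_small[of "\<bar>\<Phi> x - shift d x\<bar>" m] by auto
    then show False using close[of n] by simp
  qed
  then show ?thesis by blast
qed

lemma pointwise_shift:
  obtains Z where "Z \<in> null_sets lebesgue" "\<And>x. x \<in> G \<inter> {0..<1} - Z \<Longrightarrow> \<exists>d. \<Phi> x = shift d x"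
proof -
  have "AE x in lebesgue. \<forall>i l. i \<noteq> l \<longrightarrow> eventually (\<lambda>n. i < r n \<longrightarrow> l < r n \<longrightarrow> x \<notin> split_points n i l) sequentially"
    using eventually_not_split by (simp add: AE_all_countable)
  then obtain Z where Z: "\<And>x. x \<in> space lebesgue - Z \<Longrightarrow>
      \<forall>i l. i \<noteq> l \<longrightarrow> eventually (\<lambda>n. i < r n \<longrightarrow> l < r n \<longrightarrow> x \<notin> split_points n i l) sequentially"
    and Z_null: "Z \<in> null_sets lebesgue"
    using AE_E3 by blast
  have "\<exists>d. \<Phi> x = shift d x" if x: "x \<in> G \<inter> {0..<1} - Z" for x
  proof -
    have "eventually (\<lambda>n. \<forall>i\<in>{..<R}. \<forall>l\<in>{..<R}. i \<noteq> l \<longrightarrow> i < r n \<longrightarrow> l < r n \<longrightarrow> x \<notin> split_points n i l) sequentially"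
    proof (intro eventually_ball_finite ballI)
      fix i l
      show "eventually (\<lambda>n. i \<noteq> l \<longrightarrow> i < r n \<longrightarrow> l < r n \<longrightarrow> x \<notin> split_points n i l) sequentially"
        using Z[of x] x by (cases "i = l") simp_all
    qed simp_all
    then obtain N where N: "\<forall>n\<ge>N. \<forall>i\<in>{..<R}. \<forall>l\<in>{..<R}. i \<noteq> l \<longrightarrow> i < r n \<longrightarrow> l < r n \<longrightarrow> x \<notin> split_points n i l"
      unfolding eventually_sequentially by (rule exE)
    show ?thesis
    proof (rule same_subcolumns_imp_shift[where N="max N N0"])
      show "x \<in> G" "0 \<le> x" "x < 1" using x by auto
      fix n i l assume "max N N0 \<le> n" "i < r n" "l < r n" "i \<noteq> l"
      then show "x \<notin> split_points n i l"
        using N[rule_format, of n i l] r_less[of n] by simp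
    qed
  qed
  with Z_null show ?thesis by (rule that)
qed

lemma shift_measurable: "shift d \<in> borel_measurable (lebesgue_on Core)"
proof (rule measurableI)
  fix B :: "real set" assume "B \<in> sets borel"
  then have "B \<inter> Core \<in> sets lebesgue" using Core_sets by auto
  then have "shift (-d) ` (B \<inter> Core) \<in> sets lebesgue" by (rule shift_preserves_measure) simp
  moreover have "shift (-d) ` (B \<inter> Core) = shift d -` B \<inter> Core"
  proof (rule set_eqI)
    fix x
    have "x \<in> shift (-d) ` (B \<inter> Core) \<Longrightarrow> x \<in> Core" by (auto simp: shift_in_Core)
    moreover have "x \<in> Core \<Longrightarrow> x \<in> shift (-d) ` (B \<inter> Core) \<longleftrightarrow> shift d x \<in> B"
      using shift_image_iff[of "B \<inter> Core" x "-d"] by (simp add: shift_in_Core)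
    ultimately show "x \<in> shift (-d) ` (B \<inter> Core) \<longleftrightarrow> x \<in> shift d -` B \<inter> Core" by blast
  qed
  ultimately show "shift d -` B \<inter> space (lebesgue_on Core) \<in> sets (lebesgue_on Core)"
    using Core_sets by (simp add: sets_restrict_space_iff)
qed simp

lemma agreement_sets: "{x \<in> G. \<Phi> x = shift d x} \<in> sets lebesgue"
proof -
  have "\<Phi> \<in> measurable (lebesgue_on X) lebesgue"
    using \<Phi>_measurable X_sets by (simp add: measurable_restrict_space2_iff)
  then have "\<Phi> \<in> borel_measurable (lebesgue_on X)"
    by (rule measurable_compose[where g="\<lambda>x. x" and L=borel])
      (rule measurable_completion, simp)
  then have 1: "\<Phi> \<in> borel_measurable (lebesgue_on G)"
    by (rule measurable_restrict_mono) (use G_Core Core_subset_X in blast)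
  have 2: "shift d \<in> borel_measurable (lebesgue_on G)"
    using shift_measurable by (rule measurable_restrict_mono) (rule G_Core)
  have "{x \<in> space (lebesgue_on G). \<Phi> x = shift d x} \<in> sets (lebesgue_on G)"
    using 1 2 by measurable
  then show ?thesis using G_sets by (simp add: sets_restrict_space_iff)
qed

text \<open>
  The countably many sets on which \<open>d\<close> is constant cover the unit interval up to a null set, so
  one of them is not null; it is invariant because the shifts commute, and ergodicity applies.
\<close>

lemma eq_shift_almost_everywhere:
  obtains d where "X - {x \<in> G. \<Phi> x = shift d x} \<in> null_sets lebesgue"
proof -
  let ?A = "\<lambda>d. {x \<in> G. \<Phi> x = shift d x}"
  have "\<exists>d. ?A d \<inter> {0..<1} \<notin> null_sets lebesgue"
  proof (rule ccontr)
    assume neg: "\<not> ?thesis"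
    obtain Z where Z: "Z \<in> null_sets lebesgue" "\<And>x. x \<in> G \<inter> {0..<1} - Z \<Longrightarrow> \<exists>d. \<Phi> x = shift d x"
      using pointwise_shift by blast
    have "(\<Union>d. ?A d \<inter> {0..<1}) \<in> null_sets lebesgue" using neg by (intro null_sets_UN') auto
    then have null: "(X - G) \<union> (Z \<union> (\<Union>d. ?A d \<inter> {0..<1})) \<in> null_sets lebesgue"
      using Z(1) G_conull by (intro null_sets.Un)
    have "{0..<1} \<subseteq> X" using X_iff[of _] level_0 h_pos[of 0] by (metis subsetI)
    then have "{0..<1} \<subseteq> (X - G) \<union> (Z \<union> (\<Union>d. ?A d \<inter> {0..<1}))" using Z(2) by blast
    then have "{0..<1::real} \<in> null_sets lebesgue" by (rule null_sets_subset[OF null, rotated]) auto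
    then have "emeasure lebesgue {0..<1::real} = 0" by (rule null_setsD1)
    then show False by simp
  qed
  then obtain d where d: "?A d \<inter> {0..<1} \<notin> null_sets lebesgue" by blast
  have "X - ?A d \<in> null_sets lebesgue"
  proof (rule shift_ergodic)
    show "?A d \<in> sets lebesgue" by (rule agreement_sets)
    show "?A d \<subseteq> Core" using G_Core by blast
    fix k x assume x: "x \<in> ?A d"
    then have "x \<in> Core" using G_Core by blast
    then have "shift k (shift d x) = shift d (shift k x)" by (simp add: shift_shift add.commute)
    then show "shift k x \<in> ?A d" using x G_shift \<Phi>_shift by simp
  qed (rule d)
  then show ?thesis by (rule that)
qed

end

section \<open>From the transformation to the shifts\<close>

context stacked_columns
begin

lemma extends_columns_imp_eq_shift:
  assumes "\<forall>n j. Suc j < h n \<and> x \<in> L n j \<longrightarrow> T x = x + (a n (Suc j) - a n j)" "x \<in> Core"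
  shows "T x = shift 1 x"
proof -
  obtain n p q where n: "p + 0 < h n" "q + 0 < h n" "x \<in> L n p" "int q - int p = 1"
    using assms(2) by (rule Core_shift[where k=1 and K=0])
  then have q: "q = Suc p" by linarith
  have "shift 1 x = x + (a n (Suc p) - a n p)"
    by (rule shift_translation) (use n q in simp_all)
  moreover have "T x = x + (a n (Suc p) - a n p)" using assms(1) n q by simp
  ultimately show ?thesis by simp
qed

lemma funpow_eq_shift:
  assumes f: "\<And>x. x \<in> G \<Longrightarrow> f x = shift e x" and G: "\<And>k x. x \<in> G \<Longrightarrow> shift k x \<in> G" "G \<subseteq> Core"
    and x: "x \<in> G"
  shows "(f ^^ m) x = shift (int m * e) x"
proof (induction m)
  case 0
  then show ?case using x G(2) by (simp add: shift_0 subset_iff)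
next
  case (Suc m)
  have "(f ^^ Suc m) x = shift e (shift (int m * e) x)" using Suc f G(1)[OF x] by simp
  also have "\<dots> = shift (int (Suc m) * e) x"
    using x G(2) by (simp add: shift_shift subset_iff algebra_simps)
  finally show ?case .
qed

lemma ae_inverse_shift:
  assumes N: "N \<in> null_sets lebesgue" and T: "\<And>x. x \<in> Core - N \<Longrightarrow> T x = shift 1 x"
  shows "ae_inverse (lebesgue_on X) T (\<lambda>x. if x \<in> Core then shift (-1) x else x)"
    (is "ae_inverse _ _ ?U")
proof -
  obtain G where G: "G \<subseteq> Core - N" "X - G \<in> null_sets lebesgue" "\<And>k x. x \<in> G \<Longrightarrow> shift k x \<in> G"
    using shift_invariant_conull_subset[OF N] by metis
  have "?U \<in> measurable (lebesgue_on X) (lebesgue_on X)"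
  proof (rule measurableI)
    fix x assume "x \<in> space (lebesgue_on X)"
    then show "?U x \<in> space (lebesgue_on X)" using shift_in_Core Core_subset_X by auto
  next
    fix B assume "B \<in> sets (lebesgue_on X)"
    then have B: "B \<in> sets lebesgue" "B \<subseteq> X" using X_sets by (simp_all add: sets_restrict_space_iff)
    have "B \<inter> Core \<in> sets lebesgue" using B Core_sets by auto
    then have "shift 1 ` (B \<inter> Core) \<union> (B - Core) \<in> sets lebesgue"
      using B Core_sets by (intro sets.Un shift_preserves_measure) auto
    moreover have "?U -` B \<inter> X = shift 1 ` (B \<inter> Core) \<union> (B - Core)"
    proof (rule set_eqI)
      fix x
      have "x \<in> Core \<Longrightarrow> x \<in> shift 1 ` (B \<inter> Core) \<longleftrightarrow> shift (-1) x \<in> B"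
        using shift_image_iff[of "B \<inter> Core" x 1] by (simp add: shift_in_Core)
      moreover have "x \<in> shift 1 ` (B \<inter> Core) \<Longrightarrow> x \<in> Core" by (auto simp: shift_in_Core)
      ultimately show "x \<in> ?U -` B \<inter> X \<longleftrightarrow> x \<in> shift 1 ` (B \<inter> Core) \<union> (B - Core)"
        using B(2) Core_subset_X by (cases "x \<in> Core") (simp_all, blast+)
    qed
    ultimately show "?U -` B \<inter> space (lebesgue_on X) \<in> sets (lebesgue_on X)"
      using X_sets by (simp add: sets_restrict_space_iff) auto
  qed
  moreover have "AE x in lebesgue_on X. ?U (T x) = x"
    using G(2) X_sets
  proof (rule AE_lebesgue_onI)
    fix x assume "x \<in> G"
    then have "x \<in> Core" "T x = shift 1 x" using G(1) T by auto
    then show "?U (T x) = x" by (simp add: shift_in_Core shift_inverse)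
  qed
  moreover have "AE x in lebesgue_on X. T (?U x) = x"
    using G(2) X_sets
  proof (rule AE_lebesgue_onI)
    fix x assume "x \<in> G"
    then have "x \<in> Core" "T (shift (-1) x) = shift 1 (shift (-1) x)" using G(1,3) T by blast+
    then show "T (?U x) = x" using shift_inverse(2)[of x 1] by simp
  qed
  ultimately show ?thesis unfolding ae_inverse_def by blast
qed

lemma ae_power_eq_shift:
  assumes N: "N \<in> null_sets lebesgue" and T: "\<And>x. x \<in> Core - N \<Longrightarrow> T x = shift 1 x"
  shows "AE x in lebesgue_on X. ae_power (lebesgue_on X) T d x = shift d x"
proof (cases "0 \<le> d")
  case True
  obtain G where G: "G \<subseteq> Core - N" "X - G \<in> null_sets lebesgue" "\<And>k x. x \<in> G \<Longrightarrow> shift k x \<in> G"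
    using shift_invariant_conull_subset[OF N] by metis
  show ?thesis using G(2) X_sets
  proof (rule AE_lebesgue_onI)
    fix x assume "x \<in> G"
    then have "(T ^^ nat d) x = shift (int (nat d) * 1) x"
      by (intro funpow_eq_shift[where G=G]) (use G T in blast)+
    then show "ae_power (lebesgue_on X) T d x = shift d x" using True by (simp add: ae_power_def)
  qed
next
  case False
  define U where "U = (SOME U. ae_inverse (lebesgue_on X) T U)"
  have "ae_inverse (lebesgue_on X) T U"
    unfolding U_def using ae_inverse_shift[OF N] T by (intro someI_ex[of "ae_inverse (lebesgue_on X) T"]) blast
  then have "AE x in lebesgue_on X. U (T x) = x" unfolding ae_inverse_def by blast
  then obtain N' where N': "N' \<in> null_sets lebesgue" "\<And>x. x \<in> X - N' \<Longrightarrow> U (T x) = x"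
    using AE_lebesgue_on_null_set[OF _ X_sets] by blast
  obtain G where G: "G \<subseteq> Core - (N \<union> N')" "X - G \<in> null_sets lebesgue" "\<And>k x. x \<in> G \<Longrightarrow> shift k x \<in> G"
    using shift_invariant_conull_subset[OF null_sets.Un[OF N N'(1)]] by metis
  have U: "U x = shift (-1) x" if x: "x \<in> G" for x
  proof -
    have y: "shift (-1) x \<in> G" using G(3) x by blast
    have "x \<in> Core" using x G(1) by blast
    then have "T (shift (-1) x) = x" using T[of "shift (-1) x"] y G(1) shift_inverse(2)[of x 1] by auto
    moreover have "U (T (shift (-1) x)) = shift (-1) x"
      using N'(2)[of "shift (-1) x"] y G(1) Core_subset_X by blast
    ultimately show ?thesis by simp
  qed
  show ?thesis using G(2) X_sets
  proof (rule AE_lebesgue_onI)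
    fix x assume "x \<in> G"
    then have "(U ^^ nat (- d)) x = shift (int (nat (- d)) * (-1)) x"
      by (intro funpow_eq_shift[where G=G]) (use G U in blast)+
    then show "ae_power (lebesgue_on X) T d x = shift d x"
      using False by (simp add: ae_power_def U_def)
  qed
qed

text \<open>
  Three null sets have to be avoided along entire orbits: where \<open>T\<close> is not the shift by one, where
  \<open>\<Phi>\<close> fails to commute with \<open>T\<close>, and the \<open>\<Phi>\<close>-preimage of the points that are outside the core or
  where \<open>T\<close> is not the shift by one. The last one is null as \<open>\<Phi>\<close> preserves measure.
\<close>

lemma commutes_with_shifts:
  assumes N: "N \<in> null_sets lebesgue" and T: "\<And>x. x \<in> Core - N \<Longrightarrow> T x = shift 1 x"
    and \<Phi>: "\<Phi> \<in> measurable (lebesgue_on X) (lebesgue_on X)"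
      "distr (lebesgue_on X) (lebesgue_on X) \<Phi> = lebesgue_on X"
    and comm: "AE x in lebesgue_on X. \<Phi> (T x) = T (\<Phi> x)"
  obtains G where "G \<subseteq> Core" "G \<in> sets lebesgue" "X - G \<in> null_sets lebesgue"
    "\<And>k x. x \<in> G \<Longrightarrow> shift k x \<in> G" "\<And>x. x \<in> G \<Longrightarrow> \<Phi> x \<in> Core"
    "\<And>k x. x \<in> G \<Longrightarrow> \<Phi> (shift k x) = shift k (\<Phi> x)"
proof -
  obtain N2 where N2: "N2 \<in> null_sets lebesgue" "\<And>x. x \<in> X - N2 \<Longrightarrow> \<Phi> (T x) = T (\<Phi> x)"
    using AE_lebesgue_on_null_set[OF comm X_sets] by blast
  define N3 where "N3 = (X - Core) \<union> (N \<inter> X)"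
  have N3: "N3 \<in> null_sets lebesgue" "N3 \<subseteq> X"
    unfolding N3_def using X_minus_Core_null null_set_Int2[OF N X_sets] by auto
  have "\<Phi> -` N3 \<inter> X \<in> null_sets lebesgue"
    using measure_preserving_vimage[OF X_sets \<Phi> null_setsD2[OF N3(1)] N3(2)] null_setsD1[OF N3(1)]
    by (simp add: null_sets_def)
  then have "N \<union> N2 \<union> (\<Phi> -` N3 \<inter> X) \<in> null_sets lebesgue" using N N2(1) by auto
  then obtain G where G: "G \<subseteq> Core - (N \<union> N2 \<union> (\<Phi> -` N3 \<inter> X))" "X - G \<in> null_sets lebesgue"
    "G \<in> sets lebesgue" "\<And>k x. x \<in> G \<Longrightarrow> shift k x \<in> G"
    by (rule shift_invariant_conull_subset) blast
  have \<Phi>_X: "\<Phi> x \<in> X" if "x \<in> X" for x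
    using measurable_space[OF \<Phi>(1), of x] that by simp
  have \<Phi>_good: "\<Phi> x \<in> Core - N" if "x \<in> G" for x
    using that G(1) Core_subset_X \<Phi>_X[of x] unfolding N3_def by blast
  have one: "\<Phi> (shift 1 x) = shift 1 (\<Phi> x)" if x: "x \<in> G" for x
  proof -
    have "x \<in> Core - N" "x \<in> X - N2" using x G(1) Core_subset_X by blast+
    then show ?thesis using N2(2)[of x] T[of x] T[OF \<Phi>_good[OF x]] by simp
  qed
  have nat: "\<Phi> (shift (int m) x) = shift (int m) (\<Phi> x)" if x: "x \<in> G" for m x
  proof (induction m)
    case 0
    have "x \<in> Core" "\<Phi> x \<in> Core" using x G(1) \<Phi>_good[OF x] by blast+
    then show ?case by (simp add: shift_0)
  next
    case (Suc m)
    have c: "x \<in> Core" "\<Phi> x \<in> Core" using x G(1) \<Phi>_good[OF x] by blast+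
    have "\<Phi> (shift (int (Suc m)) x) = \<Phi> (shift 1 (shift (int m) x))"
      using c by (simp add: shift_shift add.commute)
    also have "\<dots> = shift 1 (shift (int m) (\<Phi> x))" using one[OF G(4)[OF x]] Suc by simp
    also have "\<dots> = shift (int (Suc m)) (\<Phi> x)" using c by (simp add: shift_shift add.commute)
    finally show ?case .
  qed
  have all: "\<Phi> (shift k x) = shift k (\<Phi> x)" if x: "x \<in> G" for k x
  proof (cases "0 \<le> k")
    case True
    then show ?thesis using nat[OF x, of "nat k"] by simp
  next
    case False
    let ?y = "shift k x"
    have y: "?y \<in> G" using G(4) x by blast
    have "x \<in> Core" "\<Phi> ?y \<in> Core" using x G(1) \<Phi>_good[OF y] by blast+
    moreover have "\<Phi> (shift (-k) ?y) = shift (-k) (\<Phi> ?y)" using nat[OF y, of "nat (-k)"] False by simp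
    ultimately have "\<Phi> x = shift (-k) (\<Phi> ?y)" by (simp add: shift_inverse)
    then show ?thesis using shift_inverse(2)[OF \<open>\<Phi> ?y \<in> Core\<close>, of k] by simp
  qed
  show ?thesis
  proof (rule that[of G])
    show "G \<subseteq> Core" using G(1) by blast
    show "\<And>x. x \<in> G \<Longrightarrow> \<Phi> x \<in> Core" using \<Phi>_good by blast
  qed (fact G all)+
qed

end

theorem theorem5p1:
  fixes X :: "real set" and T S' :: "real \<Rightarrow> real"
  assumes "partially_bounded X T"
    and "S' \<in> centralizer (lebesgue_on X) T"
  shows "\<exists>\<rho>::int. AE x in lebesgue_on X. S' x = ae_power (lebesgue_on X) T \<rho> x"
proof -
  obtain r s a R S N0 where cs: "cutting_and_stacking r s a" and X: "X = columns_union r s a"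
    and T_AE: "AE x in lebesgue_on X. \<forall>n j. Suc j < col_height r s n \<and> x \<in> level r a n j \<longrightarrow>
           T x = x + (a n (Suc j) - a n j)"
    and last: "\<forall>n. s n (r n - 1) = 0" and RS: "(R::int) > 0" "(S::int) > 0"
    and bounds: "\<forall>n\<ge>N0. int (r n) < R \<and>
              (\<forall>i<r n - 1. \<forall>j<r n - 1. \<bar>int (s n i) - int (s n j)\<bar> < S) \<and>
              (\<forall>i<r n - 1. s n i \<ge> length (rank_one_word r s n))"
    using assms(1) unfolding partially_bounded_def rank_one_def by blast
  interpret stacked_columns r s a by unfold_locales (rule cs)
  have word: "length (rank_one_word r s n) = col_height r s n" for n
    by (rule length_rank_one_word) (use r_pos last in auto)
  interpret long_spacer_columns r s a "nat R" N0 S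
  proof unfold_locales
    show "s n (r n - 1) = 0" for n using last by blast
    show "r n < nat R" if "N0 \<le> n" for n using bounds that by (simp add: zless_nat_eq_int_zless)
    show "\<bar>int (s n i) - int (s n j)\<bar> < S" if "N0 \<le> n" "i < r n - 1" "j < r n - 1" for n i j
      using bounds that by blast
    show "col_height r s n \<le> s n i" if "N0 \<le> n" "i < r n - 1" for n i
      using bounds that by (simp add: word)
    show "0 < S" by (rule RS)
  qed
  have S': "S' \<in> measurable (lebesgue_on X) (lebesgue_on X)" "distr (lebesgue_on X) (lebesgue_on X) S' = lebesgue_on X"
    "AE x in lebesgue_on X. S' (T x) = T (S' x)"
    using assms(2) unfolding centralizer_def invertible_measure_preserving_def by blast+
  obtain N where N: "N \<in> null_sets lebesgue"
    and N_T: "\<And>x. x \<in> X - N \<Longrightarrow> \<forall>n j. Suc j < col_height r s n \<and> x \<in> level r a n j \<longrightarrow>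
           T x = x + (a n (Suc j) - a n j)"
    using AE_lebesgue_on_null_set[OF T_AE] X_sets unfolding X by blast
  have T: "T x = shift 1 x" if "x \<in> Core - N" for x
    using that N_T[of x] Core_subset_X by (intro extends_columns_imp_eq_shift) (auto simp: X)
  obtain G where G: "G \<subseteq> Core" "G \<in> sets lebesgue" "X - G \<in> null_sets lebesgue"
    "\<And>k x. x \<in> G \<Longrightarrow> shift k x \<in> G" "\<And>x. x \<in> G \<Longrightarrow> S' x \<in> Core"
    "\<And>k x. x \<in> G \<Longrightarrow> S' (shift k x) = shift k (S' x)"
    using commutes_with_shifts[OF N T S'[unfolded X]] unfolding X by blast
  interpret commuting_map r s a "nat R" N0 S S' G
    by unfold_locales (use S' G in \<open>simp_all add: X\<close>)
  obtain d where "X - {x \<in> G. S' x = shift d x} \<in> null_sets lebesgue"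
    using eq_shift_almost_everywhere unfolding X by blast
  then have "AE x in lebesgue_on X. S' x = shift d x"
    by (rule AE_lebesgue_onI) (use X_sets X in auto)
  moreover have "AE x in lebesgue_on X. ae_power (lebesgue_on X) T d x = shift d x"
    using ae_power_eq_shift[OF N T] unfolding X .
  ultimately have "AE x in lebesgue_on X. S' x = ae_power (lebesgue_on X) T d x"
    by eventually_elim simp
  then show ?thesis by blast
qed

end
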